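(* Let $\mathcal{M}$ and $\mathcal{N}$ be regular matroids. Then the lattices of integer flows $\Lambda(\mathcal{M})$ and $\Lambda(\mathcal{N})$ are isometric if and only if the matroids $\mathcal{M}_\bullet$ and $\mathcal{N}_\bullet$ are isomorphic.
   Context: All matroids are on finite ground sets. An integer matrix is totally unimodular (TU) if every square submatrix has determinant in $\{-1,0,+1\}$. A matroid $(\mathcal{M},E)$ of rank $r$ with $|E|=m$ is regular if it is the column-matroid over $\mathbb{R}$ of some $r\times m$ TU matrix $M$ of rank $r$ whose columns are labelled by $E$ (one says $M$ represents $\mathcal{M}$). The lattice of integer flows of $\mathcal{M}$ is $\Lambda(\mathcal{M})=\ker(M)\cap\mathbb{Z}^E$, where $\ker(M)\subseteq\mathbb{R}^E$; it is a finitely generated free abelian group with the positive definite integer-valued inner product induced by the Euclidean dot product on $\mathbb{R}^E$. Its isometry class does not depend on the choice of TU representing matrix $M$. An isometry of lattices $\Lambda,\Lambda'$ is a bijection $\psi:\Lambda\to\Lambda'$ such that $\psi$ and $\psi^{-1}$ are abelian group homomorphisms that preserve the bilinear forms. For any matroid $\mathcal{M}$, $\mathcal{M}_\bullet$ denotes the minor of $\mathcal{M}$ obtained by contracting all co-loops of $\mathcal{M}$. *)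

theory Defs
  imports "Jordan_Normal_Form.DL_Rank_Submatrix"
begin

section \<open>Finite matroids\<close>

record 'a matroid =
  ground :: "'a set"
  indep :: "'a set set"

definition is_matroid :: "'a matroid \<Rightarrow> bool" where
  "is_matroid M \<longleftrightarrow>
     finite (ground M) \<and>
     indep M \<subseteq> Pow (ground M) \<and>
     {} \<in> indep M \<and>
     (\<forall>X Y. Y \<in> indep M \<longrightarrow> X \<subseteq> Y \<longrightarrow> X \<in> indep M) \<and>
     (\<forall>X\<in>indep M. \<forall>Y\<in>indep M. card X < card Y \<longrightarrow> (\<exists>y\<in>Y - X. insert y X \<in> indep M))"

definition basis_of :: "'a matroid \<Rightarrow> 'a set \<Rightarrow> 'a set \<Rightarrow> bool" where
  "basis_of M T B \<longleftrightarrow>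
     B \<in> indep M \<and> B \<subseteq> T \<and> (\<forall>B'\<in>indep M. B \<subseteq> B' \<longrightarrow> B' \<subseteq> T \<longrightarrow> B' = B)"

definition matroid_rank :: "'a matroid \<Rightarrow> nat" where
  "matroid_rank M = Max (card ` indep M)"

definition coloops :: "'a matroid \<Rightarrow> 'a set" where
  "coloops M = {e \<in> ground M. \<forall>B. basis_of M (ground M) B \<longrightarrow> e \<in> B}"

definition contract :: "'a matroid \<Rightarrow> 'a set \<Rightarrow> 'a matroid" where
  "contract M T =
     \<lparr>ground = ground M - T,
      indep = {X. X \<subseteq> ground M - T \<and> (\<exists>B. basis_of M (T \<inter> ground M) B \<and> X \<union> B \<in> indep M)}\<rparr>"

definition contract_coloops :: "'a matroid \<Rightarrow> 'a matroid" where
  "contract_coloops M = contract M (coloops M)"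

definition matroid_isomorphic :: "'a matroid \<Rightarrow> 'b matroid \<Rightarrow> bool" where
  "matroid_isomorphic M N \<longleftrightarrow>
     (\<exists>f. bij_betw f (ground M) (ground N) \<and>
          (\<forall>X. X \<subseteq> ground M \<longrightarrow> (X \<in> indep M \<longleftrightarrow> f ` X \<in> indep N)))"


section \<open>Regular matroids\<close>

definition totally_unimodular :: "int mat \<Rightarrow> bool" where
  "totally_unimodular A \<longleftrightarrow>
     (\<forall>I J. I \<subseteq> {..<dim_row A} \<longrightarrow> J \<subseteq> {..<dim_col A} \<longrightarrow> card I = card J \<longrightarrow>
        det (submatrix A I J) \<in> {-1, 0, 1})"

text \<open>
  A matrix whose columns are labelled by a set \<open>E\<close> is a matrix \<open>A\<close> together with a bijection
  \<open>c\<close> from \<open>E\<close> onto its column indices; the column labelled by \<open>e\<close> is \<open>col A (c e)\<close>.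
  Linear independence in the column matroid is that of the family (not the set) of columns, so
  equal columns with distinct labels are dependent.
\<close>

definition column_matroid :: "int mat \<Rightarrow> ('a \<Rightarrow> nat) \<Rightarrow> 'a set \<Rightarrow> 'a matroid" where
  "column_matroid A c E =
     \<lparr>ground = E,
      indep = {X. X \<subseteq> E \<and>
        (\<forall>a :: 'a \<Rightarrow> real.
           (\<forall>i<dim_row A. (\<Sum>e\<in>X. a e * real_of_int (A $$ (i, c e))) = 0) \<longrightarrow>
           (\<forall>e\<in>X. a e = 0))}\<rparr>"

definition represents :: "int mat \<Rightarrow> ('a \<Rightarrow> nat) \<Rightarrow> 'a matroid \<Rightarrow> bool" where
  "represents A c M \<longleftrightarrow>
     A \<in> carrier_mat (matroid_rank M) (card (ground M)) \<and>
     bij_betw c (ground M) {..<card (ground M)} \<and>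
     totally_unimodular A \<and>
     vec_space.rank (matroid_rank M) (map_mat real_of_int A) = matroid_rank M \<and>
     M = column_matroid A c (ground M)"

definition regular_matroid :: "'a matroid \<Rightarrow> bool" where
  "regular_matroid M \<longleftrightarrow> is_matroid M \<and> (\<exists>A c. represents A c M)"


section \<open>Lattices of integer flows\<close>

record 'v form_group = "'v monoid" +
  form :: "'v \<Rightarrow> 'v \<Rightarrow> real"

text \<open>
  Vectors in \<open>\<real>\<^sup>E\<close> are functions of type \<open>'a \<Rightarrow> real\<close> that vanish outside \<open>E\<close>. The
  group operation is vector addition, although the record fields inherited from monoids are
  written multiplicatively.
\<close>

definition flow_lattice :: "int mat \<Rightarrow> ('a \<Rightarrow> nat) \<Rightarrow> 'a set \<Rightarrow> ('a \<Rightarrow> real) form_group" where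
  "flow_lattice A c E =
     \<lparr>carrier = {x. (\<forall>e. e \<notin> E \<longrightarrow> x e = 0) \<and>
                    (\<forall>i<dim_row A. (\<Sum>e\<in>E. real_of_int (A $$ (i, c e)) * x e) = 0) \<and>
                    (\<forall>e\<in>E. x e \<in> \<int>)},
      monoid.mult = (\<lambda>x y e. x e + y e),
      monoid.one = (\<lambda>_. 0),
      form = (\<lambda>x y. \<Sum>e\<in>E. x e * y e)\<rparr>"

definition form_hom :: "'v form_group \<Rightarrow> 'w form_group \<Rightarrow> ('v \<Rightarrow> 'w) \<Rightarrow> bool" where
  "form_hom L L' \<psi> \<longleftrightarrow>
     \<psi> \<in> hom L L' \<and>
     (\<forall>x\<in>carrier L. \<forall>y\<in>carrier L. form L' (\<psi> x) (\<psi> y) = form L x y)"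

definition isometry :: "'v form_group \<Rightarrow> 'w form_group \<Rightarrow> ('v \<Rightarrow> 'w) \<Rightarrow> bool" where
  "isometry L L' \<psi> \<longleftrightarrow>
     bij_betw \<psi> (carrier L) (carrier L') \<and>
     form_hom L L' \<psi> \<and> form_hom L' L (inv_into (carrier L) \<psi>)"

definition isometric :: "'v form_group \<Rightarrow> 'w form_group \<Rightarrow> bool" where
  "isometric L L' \<longleftrightarrow> (\<exists>\<psi>. isometry L L' \<psi>)"

end

theory Submission
  imports Defs "HOL-Library.Function_Algebras"
begin

text \<open>
  Why the theorem is true. Write \<open>\<Lambda>\<close> for the set of integer flows of \<open>M\<close>, a subgroup of the
  integer functions on \<open>E\<close>. Cramer's rule for a totally unimodular matrix shows that \<open>\<Lambda>\<close> is
  \<^emph>\<open>regular\<close>: below every nonzero flow \<open>x\<close> there is a nonzero flow whose entries are \<open>0\<close> or the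
  sign of \<open>x\<close> (\<open>int_flows_regular\<close>). So every flow is a sum of \<open>{-1, 0, 1}\<close>-valued flows without
  cancellation. The matroid can be read off from \<open>\<Lambda>\<close>: a set is independent iff it does not contain
  the support of a nonzero flow, an element is a coloop iff all flows vanish on it, and contracting
  the coloops just discards those coordinates (\<open>contract_coloops_iff\<close>). From here on only regular
  lattices matter: they are isometric iff some bijection of their active coordinates preserves
  which sets contain the support of a nonzero flow (\<open>isometric_iff_flow_bijection\<close>).

  From an isometry to a bijection. Among the flows, those with entries in \<open>{-1, 0, 1}\<close> are
  exactly the \<open>x\<close> with \<open>\<langle>y, x - y\<rangle> \<le> 0\<close> for all flows \<open>y\<close>, and on them the squared length is the
  L1 norm. As every flow is a conformal sum of such flows, its L1 norm is the least total
  squared length of a decomposition into such flows, so isometries preserve the L1 norm (\<open>isometry_norm1\<close>).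
  Now \<open>\<Sum>\<^sub>e \<bar>x\<^sub>e\<bar>\<close> is a piecewise linear function of \<open>x\<close>, and its kinks reveal the coordinate
  functionals up to sign, with multiplicity (\<open>equal_multiplicities\<close>). Hence an isometry matches
  the active coordinates of the two lattices up to signs, and it transports supports.

  From a bijection to an isometry. After renaming coordinates the two lattices \<open>L\<close> and \<open>K\<close> live on
  the same set, and the same sets contain supports of nonzero flows. They then differ only by sign
  changes of coordinates (\<open>unique_signing\<close>), the uniqueness of regular representations. The proof
  deletes an element \<open>e\<close>, so that by induction the flows vanishing at \<open>e\<close> may be assumed to
  coincide, and takes a circuit \<open>C\<close> through \<open>e\<close> with its two signings \<open>y \<in> L\<close> and \<open>y' \<in> K\<close>. The
  signings disagree on a set \<open>U\<close> and agree on a set \<open>V\<close>. A circuit of the common deletion together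
  with \<open>C\<close> contains theta-shaped configurations, in which the new circuit has constant sign relative
  to each signing of \<open>C\<close>; so it cannot meet both \<open>U\<close> and \<open>V\<close> (\<open>elementary_one_sided\<close>). Flipping the
  connected components of the deletion that meet \<open>U\<close> therefore turns \<open>y\<close> into \<open>y'\<close> and keeps the
  common part.
\<close>

section \<open>Kernel vectors of totally unimodular matrices\<close>

text \<open>
  Square submatrices are defined by sets of rows and columns, in increasing order. For bordering it
  is more convenient to list rows and columns in any order, which only permutes them.
\<close>
lemma enumeration_by_pick:
  fixes f :: "nat \<Rightarrow> nat"
  assumes "inj_on f {..<k}"
  obtains p where "p permutes {0..<k}" and "\<And>i. i < k \<Longrightarrow> f i = pick (f ` {..<k}) (p i)"
proof -
  define S where "S = f ` {..<k}"
  define p where "p = (\<lambda>i. if i < k then card {a \<in> S. a < f i} else i)"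
  have card_S: "card S = k" and fin: "finite S"
    using assms by (simp_all add: S_def card_image)
  have f_eq: "f i = pick S (p i)" if "i < k" for i
    using that pick_card_in_set[of "f i" S] by (simp add: p_def S_def)
  have "inj_on p {0..<k}"
    using f_eq assms by (simp add: inj_on_def)
  moreover have "p i < k" if "i < k" for i
  proof -
    have "{a \<in> S. a < f i} \<subset> S" using that by (auto simp: S_def)
    from psubset_card_mono[OF fin this] show ?thesis using that card_S by (simp add: p_def)
  qed
  hence "p ` {0..<k} \<subseteq> {0..<k}" by auto
  ultimately have "bij_betw p {0..<k} {0..<k}"
    by (simp add: bij_betw_def endo_inj_surj)
  hence "p permutes {0..<k}"
    by (rule bij_imp_permutes) (simp add: p_def)
  with f_eq that show ?thesis by (simp add: S_def)
qed

lemma signof_mult_unimodular: "z \<in> {-1, 0, 1} \<Longrightarrow> signof p * z \<in> {-1, 0, 1 :: int}"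
  by (cases p rule: sign_cases) auto

lemma totally_unimodular_det_rows:
  assumes "totally_unimodular A"
    and f: "\<And>i. i < k \<Longrightarrow> f i < dim_row A"
    and J: "J \<subseteq> {..<dim_col A}" "card J = k"
  shows "det (mat k k (\<lambda>(i, j). A $$ (f i, pick J j))) \<in> {-1, 0, 1}" (is "det ?B \<in> _")
proof (cases "inj_on f {..<k}")
  case True
  then obtain p where p: "p permutes {0..<k}" "\<And>i. i < k \<Longrightarrow> f i = pick (f ` {..<k}) (p i)"
    by (rule enumeration_by_pick) blast
  define S where "S = f ` {..<k}"
  have S: "S \<subseteq> {..<dim_row A}" "card S = k" using f True by (auto simp: S_def card_image)
  have "{i. i < dim_row A \<and> i \<in> S} = S" "{j. j < dim_col A \<and> j \<in> J} = J" using S J by auto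
  hence sub: "submatrix A S J = mat k k (\<lambda>(i, j). A $$ (pick S i, pick J j))"
    by (simp add: submatrix_def S J)
  have "?B = mat k k (\<lambda>(i, j). submatrix A S J $$ (p i, j))"
    using permutes_in_image[OF p(1)] by (intro eq_matI) (simp_all add: sub p(2)[folded S_def])
  also have "det \<dots> = signof p * det (submatrix A S J)"
    by (rule det_permute_rows[OF _ p(1)]) (simp add: sub)
  finally show ?thesis
    using assms(1) S J signof_mult_unimodular[of "det (submatrix A S J)" p]
    unfolding totally_unimodular_def by metis
next
  case False
  then obtain i i' where "i < k" "i' < k" "i \<noteq> i'" "f i = f i'" by (auto simp: inj_on_def)
  hence "det ?B = 0"
    by (intro det_identical_rows[of _ k i i']) (auto intro!: eq_vecI)
  thus ?thesis by simp
qed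

text \<open>Repeated indices are harmless here, since they make the determinant vanish.\<close>
lemma totally_unimodular_det:
  assumes "totally_unimodular A"
    and f: "\<And>i. i < k \<Longrightarrow> f i < dim_row A"
    and g: "\<And>j. j < k \<Longrightarrow> g j < dim_col A"
  shows "det (mat k k (\<lambda>(i, j). A $$ (f i, g j))) \<in> {-1, 0, 1}" (is "det ?B \<in> _")
proof (cases "inj_on g {..<k}")
  case True
  then obtain p where p: "p permutes {0..<k}" "\<And>i. i < k \<Longrightarrow> g i = pick (g ` {..<k}) (p i)"
    by (rule enumeration_by_pick) blast
  define S where "S = g ` {..<k}"
  define C where "C = mat k k (\<lambda>(i, j). A $$ (f i, pick S j))"
  have C: "det C \<in> {-1, 0, 1}"
    unfolding C_def S_def using g True
    by (intro totally_unimodular_det_rows[OF assms(1) f]) (auto simp: card_image)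
  have "transpose_mat ?B = mat k k (\<lambda>(i, j). transpose_mat C $$ (p i, j))"
    using permutes_in_image[OF p(1)] by (intro eq_matI) (simp_all add: C_def p(2)[folded S_def])
  also have "det \<dots> = signof p * det (transpose_mat C)"
    by (rule det_permute_rows[OF _ p(1)]) (simp add: C_def)
  finally have "det ?B = signof p * det C"
    by (simp add: det_transpose[of _ k] C_def)
  thus ?thesis using C signof_mult_unimodular by metis
next
  case False
  then obtain i i' where "i < k" "i' < k" "i \<noteq> i'" "g i = g i'" by (auto simp: inj_on_def)
  hence "det ?B = 0"
    by (intro det_identical_cols[of _ k i i']) (auto intro!: eq_vecI)
  thus ?thesis by simp
qed

text \<open>
  A form of Cramer's rule that avoids ranks. Take a nonvanishing minor of maximal size with columns
  in \<open>X\<close>. It cannot use all of \<open>X\<close>, since it would then force the given dependence \<open>x\<close> to vanish; so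
  there is room for one more column. Bordering the minor with this column and any row \<open>r\<close> gives
  determinant \<open>0\<close>, and its cofactors along the new row do not depend on \<open>r\<close>. These cofactors form
  the required kernel vector: they are minors up to sign, and one of them is the chosen minor.
\<close>
lemma unimodular_kernel_vector:
  fixes x :: "nat \<Rightarrow> real"
  assumes A: "totally_unimodular A"
    and X: "finite X" "X \<subseteq> {..<dim_col A}"
    and ker: "\<And>i. i < dim_row A \<Longrightarrow> (\<Sum>e\<in>X. real_of_int (A $$ (i, e)) * x e) = 0"
    and nz: "e0 \<in> X" "x e0 \<noteq> 0"
  obtains v :: "nat \<Rightarrow> int" where "\<And>e. v e \<in> {-1, 0, 1}" "\<And>e. e \<notin> X \<Longrightarrow> v e = 0"
    "\<exists>e. v e \<noteq> 0" "\<And>i. i < dim_row A \<Longrightarrow> (\<Sum>e\<in>X. A $$ (i, e) * v e) = 0"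
proof -
  define B where "B = (\<lambda>k (f :: nat \<Rightarrow> nat) (g :: nat \<Rightarrow> nat). mat k k (\<lambda>(i, j). A $$ (f i, g j)))"
  define P where "P = (\<lambda>k. \<exists>f g. (\<forall>i<k. f i < dim_row A) \<and> (\<forall>j<k. g j \<in> X) \<and> det (B k f g) \<noteq> 0)"
  have B_carrier: "B k f g \<in> carrier_mat k k" for k f g by (simp add: B_def)
  have inj: "inj_on g {..<k}" if "det (B k f g) \<noteq> 0" for k f g
  proof (rule ccontr)
    assume "\<not> inj_on g {..<k}"
    then obtain i i' where "i < k" "i' < k" "i \<noteq> i'" "g i = g i'" by (auto simp: inj_on_def)
    hence "det (B k f g) = 0"
      by (intro det_identical_cols[of _ k i i']) (auto simp: B_def intro!: eq_vecI)
    with that show False by simp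
  qed
  have bound: "k \<le> card X" if "P k" for k
  proof -
    from that obtain f g where "\<forall>j<k. g j \<in> X" "det (B k f g) \<noteq> 0" by (auto simp: P_def)
    with inj card_inj_on_le[of g "{..<k}" X] X(1) show ?thesis by auto
  qed
  have "P 0" by (auto simp: P_def B_def det_def)
  define k where "k = (GREATEST k. P k)"
  have "P k" and max: "\<And>n. P n \<Longrightarrow> n \<le> k"
    using GreatestI_nat[of P 0 "card X"] Greatest_le_nat[of P _ "card X"] \<open>P 0\<close> bound
    by (auto simp: k_def)
  then obtain f g where f: "\<And>i. i < k \<Longrightarrow> f i < dim_row A" and g: "\<And>j. j < k \<Longrightarrow> g j \<in> X"
    and det: "det (B k f g) \<noteq> 0" by (auto simp: P_def)
  have "g ` {..<k} \<noteq> X"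
  proof
    assume gX: "g ` {..<k} = X"
    let ?R = "map_mat real_of_int (B k f g)"
    let ?y = "vec k (\<lambda>j. x (g j))"
    have "?R *\<^sub>v ?y = 0\<^sub>v k"
    proof (intro eq_vecI)
      fix i assume "i < dim_vec (0\<^sub>v k :: real vec)"
      hence i: "i < k" by simp
      have "(?R *\<^sub>v ?y) $ i = (\<Sum>j<k. real_of_int (A $$ (f i, g j)) * x (g j))"
        using i by (auto simp: B_def scalar_prod_def lessThan_atLeast0 intro!: sum.cong)
      also have "\<dots> = (\<Sum>e\<in>X. real_of_int (A $$ (f i, e)) * x e)"
        using sum.reindex[OF inj[OF det], of "\<lambda>e. real_of_int (A $$ (f i, e)) * x e"]
        by (simp add: gX)
      finally show "(?R *\<^sub>v ?y) $ i = 0\<^sub>v k $ i" using ker f i by simp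
    qed (simp add: B_def)
    moreover have "?y \<noteq> 0\<^sub>v k"
      using nz gX by (auto simp: vec_eq_iff)
    ultimately have "det ?R = 0"
      using det_0_iff_vec_prod_zero[of ?R k] B_carrier by (metis map_carrier_mat vec_carrier)
    with det show False by simp
  qed
  then obtain e1 where e1: "e1 \<in> X" "e1 \<notin> g ` {..<k}" using g by auto
  define g' where "g' = g(k := e1)"
  define f' where "f' = (\<lambda>r. f(k := r))"
  have g': "g' j \<in> X" if "j < Suc k" for j using that g e1 by (auto simp: g'_def less_Suc_eq)
  have g'_inj: "inj_on g' {..<Suc k}"
    using inj[OF det] e1 by (auto simp: g'_def inj_on_def less_Suc_eq)
  have det0: "det (B (Suc k) (f' r) g') = 0" if "r < dim_row A" for r
  proof (rule ccontr)
    assume "det (B (Suc k) (f' r) g') \<noteq> 0"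
    moreover have "\<forall>i<Suc k. f' r i < dim_row A" using f that by (auto simp: f'_def less_Suc_eq)
    ultimately have "P (Suc k)" using g' unfolding P_def by blast
    with max show False by fastforce
  qed
  \<comment> \<open>The cofactors along the last row of the bordered matrix; deleting that row removes \<open>r\<close>.\<close>
  define co where "co = (\<lambda>j. (-1) ^ (k + j) * det (B k f (\<lambda>l. g' (insert_index j l))))"
  have ins: "insert_index j l < Suc k" if "l < k" for j l using that by (auto simp: insert_index_def)
  have cof: "cofactor (B (Suc k) (f' r) g') k j = co j" if "j < Suc k" for r j
  proof -
    have "mat_delete (B (Suc k) (f' r) g') k j = B k f (\<lambda>l. g' (insert_index j l))"
    proof (intro eq_matI)
      fix a b assume "a < dim_row (B k f (\<lambda>l. g' (insert_index j l)))"
        "b < dim_col (B k f (\<lambda>l. g' (insert_index j l)))"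
      hence ab: "a < k" "b < k" by (auto simp: B_def)
      have "mat_delete (B (Suc k) (f' r) g') k j $$ (a, b)
        = B (Suc k) (f' r) g' $$ (insert_index k a, insert_index j b)"
        using mat_delete_index[OF B_carrier, of k k j a b] that ab by simp
      also have "\<dots> = B k f (\<lambda>l. g' (insert_index j l)) $$ (a, b)"
        using ab ins[OF ab(2), of j] by (simp add: B_def insert_index_def f'_def)
      finally show "mat_delete (B (Suc k) (f' r) g') k j $$ (a, b)
        = B k f (\<lambda>l. g' (insert_index j l)) $$ (a, b)" .
    qed (auto simp: B_def mat_delete_def)
    thus ?thesis by (simp add: cofactor_def co_def)
  qed
  have co_unimod: "co j \<in> {-1, 0, 1}" for j
  proof -
    have "det (B k f (\<lambda>l. g' (insert_index j l))) \<in> {-1, 0, 1}"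
      unfolding B_def by (rule totally_unimodular_det[OF A f]) (use g' ins X in blast)+
    thus ?thesis by (cases "even (k + j)") (auto simp: co_def)
  qed
  have "B k f (\<lambda>l. g' (insert_index k l)) = B k f g"
    by (auto simp: B_def g'_def insert_index_def)
  hence co_k: "co k \<noteq> 0" using det by (simp add: co_def)
  define idx where "idx = inv_into {..<Suc k} g'"
  define v where "v = (\<lambda>e. if e \<in> g' ` {..<Suc k} then co (idx e) else 0)"
  have v_g': "v (g' j) = co j" if "j < Suc k" for j
    using that inv_into_f_f[OF g'_inj, of j] unfolding v_def idx_def by auto
  show ?thesis
  proof
    show "v e \<in> {-1, 0, 1}" for e using co_unimod[of "idx e"] by (auto simp: v_def)
    show "v e = 0" if "e \<notin> X" for e using that g' by (auto simp: v_def)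
    show "\<exists>e. v e \<noteq> 0" using v_g'[of k] co_k by (intro exI[of _ "g' k"]) simp
    fix r assume r: "r < dim_row A"
    have "(\<Sum>e\<in>X. A $$ (r, e) * v e) = (\<Sum>e\<in>g' ` {..<Suc k}. A $$ (r, e) * v e)"
      using X(1) g' by (intro sum.mono_neutral_right) (auto simp: v_def)
    also have "\<dots> = (\<Sum>j<Suc k. A $$ (r, g' j) * v (g' j))"
      by (rule sum.reindex_cong[OF g'_inj]) auto
    also have "\<dots> = (\<Sum>j<Suc k. B (Suc k) (f' r) g' $$ (k, j) * cofactor (B (Suc k) (f' r) g') k j)"
      using cof v_g' by (intro sum.cong) (auto simp: B_def f'_def)
    also have "\<dots> = det (B (Suc k) (f' r) g')"
      using laplace_expansion_row[OF B_carrier, of k "Suc k" "f' r" g'] by simp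
    finally show "(\<Sum>e\<in>X. A $$ (r, e) * v e) = 0" using det0[OF r] by simp
  qed
qed

section \<open>Regular lattices\<close>

definition supp :: "('a \<Rightarrow> int) \<Rightarrow> 'a set" where
  "supp x = {e. x e \<noteq> 0}"

text \<open>
  \<open>c\<close> arises from the sign vector of \<open>x\<close> by replacing some entries by \<open>0\<close>. Then \<open>x - c\<close> keeps the
  signs of \<open>x\<close> wherever it is nonzero, so that such parts can be split off one after another.
\<close>
definition sign_part :: "('a \<Rightarrow> int) \<Rightarrow> ('a \<Rightarrow> int) \<Rightarrow> bool" where
  "sign_part c x \<longleftrightarrow> (\<forall>e. c e = 0 \<or> c e = sgn (x e))"

definition norm1 :: "'a set \<Rightarrow> ('a \<Rightarrow> int) \<Rightarrow> int" where
  "norm1 E x = (\<Sum>e\<in>E. \<bar>x e\<bar>)"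

definition int_dot :: "'a set \<Rightarrow> ('a \<Rightarrow> int) \<Rightarrow> ('a \<Rightarrow> int) \<Rightarrow> int" where
  "int_dot E x y = (\<Sum>e\<in>E. x e * y e)"

text \<open>For the lattice of flows of a matroid, these are the nonzero multiples of signed circuits.\<close>
definition elementary :: "('a \<Rightarrow> int) set \<Rightarrow> ('a \<Rightarrow> int) \<Rightarrow> bool" where
  "elementary L c \<longleftrightarrow> c \<in> L \<and> c \<noteq> 0 \<and> (\<forall>x\<in>L. x \<noteq> 0 \<longrightarrow> supp x \<subseteq> supp c \<longrightarrow> supp x = supp c)"

text \<open>For the lattice of flows of a matroid, these are the dependent sets \<open>X\<close>.\<close>
definition carries_flow :: "('a \<Rightarrow> int) set \<Rightarrow> 'a set \<Rightarrow> bool" where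
  "carries_flow L X \<longleftrightarrow> (\<exists>x\<in>L. x \<noteq> 0 \<and> supp x \<subseteq> X)"

lemma supp_iff: "e \<in> supp x \<longleftrightarrow> x e \<noteq> 0"
  by (simp add: supp_def)

lemma supp_subsetD: "supp x \<subseteq> supp y \<Longrightarrow> y e = 0 \<Longrightarrow> x e = 0"
  by (auto simp: supp_def)

lemma nonzero_obtain:
  fixes x :: "'a \<Rightarrow> int"
  assumes "x \<noteq> 0" obtains e where "x e \<noteq> 0"
  using assms by (auto simp: fun_eq_iff)

lemma sign_part_unit: "sign_part c x \<Longrightarrow> c e \<in> {-1, 0, 1}"
  unfolding sign_part_def using sgn_if[of "x e"] by (metis insertCI)

lemma sign_part_supp: "sign_part c x \<Longrightarrow> supp c \<subseteq> supp x"
  unfolding sign_part_def supp_def by (force simp: sgn_if)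

lemma sign_part_abs_diff: "sign_part c x \<Longrightarrow> \<bar>x e - c e\<bar> = \<bar>x e\<bar> - \<bar>c e\<bar>"
  unfolding sign_part_def
  by (drule spec[of _ e]) (auto simp: sgn_if abs_if split: if_splits)

text \<open>Decomposing a flow into unit flows without cancellation amounts to iterating this step.\<close>
lemma sign_part_diff_trans: "sign_part b x \<Longrightarrow> sign_part c (x - b) \<Longrightarrow> sign_part c x"
  unfolding sign_part_def
  by (intro allI, drule spec, drule spec) (auto simp: sgn_if split: if_splits)

lemma norm1_diff_part:
  "sign_part c x \<Longrightarrow> norm1 E (x - c) = norm1 E x - norm1 E c"
  by (simp add: norm1_def sign_part_abs_diff sum_subtractf)

lemma norm1_nonneg: "norm1 E x \<ge> 0"
  by (simp add: norm1_def sum_nonneg)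

lemma subgroup_scale:
  assumes "(0 :: 'a \<Rightarrow> int) \<in> G" and "\<And>x y. x \<in> G \<Longrightarrow> y \<in> G \<Longrightarrow> x - y \<in> G" and "x \<in> G"
  shows "(\<lambda>e. k * x e) \<in> G"
proof (induction k rule: int_induct[where k = 0])
  case base
  then show ?case using assms(1) by (simp add: zero_fun_def)
next
  case (step1 i)
  have "(\<lambda>e. i * x e) - (0 - x) \<in> G" using step1 assms by blast
  moreover have "(\<lambda>e. (i + 1) * x e) = (\<lambda>e. i * x e) - (0 - x)" by (auto simp: algebra_simps)
  ultimately show ?case by simp
next
  case (step2 i)
  have "(\<lambda>e. i * x e) - x \<in> G" using step2 assms by blast
  moreover have "(\<lambda>e. (i - 1) * x e) = (\<lambda>e. i * x e) - x" by (auto simp: algebra_simps)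
  ultimately show ?case by simp
qed

text \<open>
  The only property of totally unimodular representations that the main argument uses. It passes
  to deletions, to coordinate projections (that is, contractions) and to sign changes.
\<close>
locale regular_lattice =
  fixes E :: "'a set" and L :: "('a \<Rightarrow> int) set"
  assumes finite_ground: "finite E"
    and outside: "x \<in> L \<Longrightarrow> e \<notin> E \<Longrightarrow> x e = 0"
    and zero_mem: "0 \<in> L"
    and diff_mem: "x \<in> L \<Longrightarrow> y \<in> L \<Longrightarrow> x - y \<in> L"
    and conformal_ex: "x \<in> L \<Longrightarrow> x \<noteq> 0 \<Longrightarrow> \<exists>c\<in>L. c \<noteq> 0 \<and> sign_part c x"
begin

lemma scale_mem: "x \<in> L \<Longrightarrow> (\<lambda>e. k * x e) \<in> L"
  by (rule subgroup_scale[OF zero_mem diff_mem])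

lemma uminus_mem: "x \<in> L \<Longrightarrow> - x \<in> L"
  using diff_mem[OF zero_mem, of x] by simp

lemma add_mem: "x \<in> L \<Longrightarrow> y \<in> L \<Longrightarrow> x + y \<in> L"
  using diff_mem[of x "- y"] uminus_mem by simp

lemma comb_mem: "x \<in> L \<Longrightarrow> y \<in> L \<Longrightarrow> (\<lambda>e. j * x e - k * y e) \<in> L"
  using diff_mem[OF scale_mem scale_mem, of x y j k] by (simp add: fun_diff_def)

lemma supp_subset: "x \<in> L \<Longrightarrow> supp x \<subseteq> E"
  using outside by (auto simp: supp_def)

lemma finite_supp: "x \<in> L \<Longrightarrow> finite (supp x)"
  using supp_subset finite_ground finite_subset by blast

lemma norm1_pos:
  assumes "x \<in> L" "x \<noteq> 0" shows "norm1 E x > 0"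
proof -
  obtain e where e: "x e \<noteq> 0" using assms(2) by (rule nonzero_obtain)
  moreover have "e \<in> E" using e outside assms(1) by blast
  ultimately show ?thesis
    unfolding norm1_def using finite_ground by (intro sum_pos2[of _ e]) auto
qed

lemma part_through:
  assumes "x \<in> L" "x e \<noteq> 0"
  obtains c where "c \<in> L" "sign_part c x" "c e \<noteq> 0"
proof -
  have "\<exists>c\<in>L. sign_part c x \<and> c e \<noteq> 0"
    using assms
  proof (induction "nat (norm1 E x)" arbitrary: x rule: less_induct)
    case less
    then have "x \<noteq> 0" by auto
    then obtain b where b: "b \<in> L" "b \<noteq> 0" "sign_part b x" using conformal_ex less by blast
    show ?case
    proof (cases "b e = 0")
      case True
      have "norm1 E (x - b) < norm1 E x"
        using norm1_diff_part[OF b(3)] norm1_pos b by simp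
      then have "nat (norm1 E (x - b)) < nat (norm1 E x)"
        using norm1_nonneg[of E "x - b"] by linarith
      then obtain c where "c \<in> L" "sign_part c (x - b)" "c e \<noteq> 0"
        using less.hyps[of "x - b"] diff_mem b(1) less.prems True by auto
      then show ?thesis using sign_part_diff_trans b(3) by blast
    qed (use b in blast)
  qed
  then show ?thesis using that by blast
qed

text \<open>Subtracting a multiple to kill the coordinate \<open>e\<close> leaves a flow with smaller support.\<close>
lemma elementary_multiple:
  assumes "elementary L c" "x \<in> L" "supp x \<subseteq> supp c" "c e \<noteq> 0"
  shows "c e * x f = x e * c f"
proof -
  define z where "z = (\<lambda>f. c e * x f - x e * c f)"
  have zL: "z \<in> L" unfolding z_def using assms by (intro comb_mem) (auto simp: elementary_def)
  have "supp z \<subseteq> supp c" using assms(3) by (auto simp: z_def supp_def)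
  moreover have "z e = 0" by (simp add: z_def)
  ultimately have "z = 0" using assms(1,4) zL unfolding elementary_def by (metis supp_iff)
  then show ?thesis by (auto simp: z_def fun_eq_iff)
qed

text \<open>
  A flow with smallest support among those inside \<open>supp x\<close> that are nonzero at \<open>e\<close> is elementary:
  a flow with smaller support would vanish at \<open>e\<close>, and could be used to eliminate another coordinate.
  Any unit flow below it has the same support.
\<close>
lemma elementary_through:
  assumes "x \<in> L" "x e \<noteq> 0"
  obtains c where "elementary L c" "supp c \<subseteq> supp x" "c e = 1" "\<And>f. c f \<in> {-1, 0, 1}"
proof -
  define P where "P = (\<lambda>c. c \<in> L \<and> supp c \<subseteq> supp x \<and> c e \<noteq> 0)"
  have "P x" using assms by (simp add: P_def)
  then obtain c0 where c0: "P c0" and min: "\<And>c. P c \<Longrightarrow> card (supp c0) \<le> card (supp c)"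
    using ex_has_least_nat[of P x "\<lambda>c. card (supp c)"] by blast
  have el0: "supp w = supp c0" if w: "w \<in> L" "w \<noteq> 0" "supp w \<subseteq> supp c0" for w
  proof (rule ccontr)
    assume ne: "supp w \<noteq> supp c0"
    have fin: "finite (supp c0)" using c0 finite_supp by (auto simp: P_def)
    show False
    proof (cases "w e = 0")
      case False
      have "card (supp w) < card (supp c0)" using fin w ne by (intro psubset_card_mono) auto
      moreover have "P w" using False w c0 by (auto simp: P_def)
      ultimately show False using min by fastforce
    next
      case True
      obtain f where f: "w f \<noteq> 0" using w(2) by (rule nonzero_obtain)
      define z where "z = (\<lambda>g. w f * c0 g - c0 f * w g)"
      have "z \<in> L" using w c0 by (auto simp: z_def P_def intro: comb_mem)
      moreover have sub: "supp z \<subseteq> supp c0" using w(3) by (auto simp: z_def supp_def)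
      moreover have "z e \<noteq> 0" using True f c0 by (auto simp: z_def P_def)
      ultimately have "P z" using c0 by (auto simp: P_def)
      moreover have "f \<in> supp c0 - supp z" using w(3) f by (auto simp: z_def supp_def)
      with sub fin have "card (supp z) < card (supp c0)" by (intro psubset_card_mono) auto
      ultimately show False using min by fastforce
    qed
  qed
  have c0': "c0 \<in> L" "c0 \<noteq> 0" "c0 e \<noteq> 0" using c0 by (auto simp: P_def)
  obtain b where b: "b \<in> L" "sign_part b c0" "b e \<noteq> 0" using part_through[OF c0'(1,3)] by blast
  have "b \<noteq> 0" using b(3) by auto
  hence bs: "supp b = supp c0" using el0 b(1) sign_part_supp[OF b(2)] by blast
  define c where "c = (\<lambda>f. b e * b f)"
  have be: "b e \<in> {-1, 1}" using b sign_part_unit[OF b(2), of e] by auto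
  have cs: "supp c = supp c0" unfolding bs[symmetric] using be by (auto simp: c_def supp_def)
  show ?thesis
  proof
    show "elementary L c"
    proof -
      have "c \<in> L" unfolding c_def using b(1) by (rule scale_mem)
      moreover have "c e \<noteq> 0" using be by (auto simp: c_def)
      hence "c \<noteq> 0" by auto
      ultimately show ?thesis unfolding elementary_def cs using el0 by blast
    qed
    show "supp c \<subseteq> supp x" using cs c0 by (simp add: P_def)
    show "c e = 1" using be by (auto simp: c_def)
    show "c f \<in> {-1, 0, 1}" for f using be sign_part_unit[OF b(2), of f] by (auto simp: c_def)
  qed
qed

text \<open>
  Here the elementary flow has to conform to the signs of \<open>x\<close>, so coordinates can no longer be
  eliminated freely. Take a conformal unit flow \<open>c\<close> of smallest support and suppose that \<open>b\<close> is a
  unit flow with smaller support. Up to sign, \<open>b\<close> agrees with \<open>c\<close> somewhere; then \<open>c - b\<close> has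
  entries \<open>0\<close>, \<open>c\<close> or \<open>2 c\<close>, hence the signs of \<open>c\<close>, and it has lost a coordinate.
\<close>
lemma elementary_part:
  assumes "x \<in> L" "x \<noteq> 0"
  obtains c where "elementary L c" "sign_part c x"
proof -
  define P where "P = (\<lambda>c. c \<in> L \<and> c \<noteq> 0 \<and> sign_part c x)"
  have "\<exists>c. P c" using conformal_ex assms by (auto simp: P_def)
  then obtain c where c: "P c" and min: "\<And>d. P d \<Longrightarrow> card (supp c) \<le> card (supp d)"
    using ex_has_least_nat[of P _ "\<lambda>c. card (supp c)"] by blast
  have cL: "c \<in> L" and c0: "c \<noteq> 0" and cx: "sign_part c x" using c by (auto simp: P_def)
  have "supp w = supp c" if w: "w \<in> L" "w \<noteq> 0" "supp w \<subseteq> supp c" for w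
  proof (rule ccontr)
    assume ne: "supp w \<noteq> supp c"
    obtain b where b: "b \<in> L" "b \<noteq> 0" "sign_part b w" using conformal_ex w by blast
    obtain f where f: "b f \<noteq> 0" using b(2) by (rule nonzero_obtain)
    have bw: "supp b \<subseteq> supp w" using b(3) by (rule sign_part_supp)
    have cf: "c f \<noteq> 0" using f bw w(3) by (auto simp: supp_def)
    define d where "d = (\<lambda>e. 1 * c e - (b f * c f) * b e)"
    have dL: "d \<in> L" unfolding d_def using cL b by (intro comb_mem)
    have "b f \<in> {-1, 1}" "c f \<in> {-1, 1}"
      using f cf sign_part_unit[OF b(3), of f] sign_part_unit[OF cx, of f] by auto
    hence df: "d f = 0" and bcf: "b f * c f \<in> {-1, 1}" by (auto simp: d_def)
    have "d \<noteq> 0"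
    proof -
      obtain g where "c g \<noteq> 0" "w g = 0" using ne w(3) by (auto simp: supp_def)
      moreover have "b g = 0" using bw \<open>w g = 0\<close> by (rule supp_subsetD)
      ultimately have "d g \<noteq> 0" by (simp add: d_def)
      thus ?thesis by auto
    qed
    then obtain a where a: "a \<in> L" "a \<noteq> 0" "sign_part a d" using conformal_ex dL by blast
    have ac: "sign_part a c"
      unfolding sign_part_def
    proof
      fix e
      have "c e = 0 \<Longrightarrow> b e = 0" using bw w(3) by (meson supp_subsetD)
      hence "d e = 0 \<or> sgn (d e) = sgn (c e)"
        using bcf sign_part_unit[OF b(3), of e] sign_part_unit[OF cx, of e] by (auto simp: d_def)
      thus "a e = 0 \<or> a e = sgn (c e)" using a(3) unfolding sign_part_def by (metis sgn_0)
    qed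
    have "sign_part a x"
      using ac cx unfolding sign_part_def by (metis sgn_0 sgn_sgn)
    hence "P a" using a by (simp add: P_def)
    moreover have "supp a \<subseteq> supp c" "a f = 0"
      using sign_part_supp[OF ac] supp_subsetD[OF sign_part_supp[OF a(3)] df] by auto
    hence "supp a \<subset> supp c" using cf by (auto simp: supp_def)
    hence "card (supp a) < card (supp c)" using finite_supp[OF cL] by (intro psubset_card_mono)
    ultimately show False using min by fastforce
  qed
  hence "elementary L c" using cL c0 by (auto simp: elementary_def)
  thus ?thesis using that cx by blast
qed

text \<open>
  Eliminating coordinates of \<open>x\<close> by unit elementary flows inside its support needs integer
  multiples only, because their pivot entry is \<open>1\<close>.
\<close>
lemma elementary_generate:
  assumes "0 \<in> G" and "\<And>x y. x \<in> G \<Longrightarrow> y \<in> G \<Longrightarrow> x - y \<in> G"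
    and "\<And>c. elementary L c \<Longrightarrow> c \<in> G"
  shows "L \<subseteq> G"
proof
  fix x assume "x \<in> L"
  then show "x \<in> G"
  proof (induction "card (supp x)" arbitrary: x rule: less_induct)
    case less
    show ?case
    proof (cases "x = 0")
      case False
      then obtain e where e: "x e \<noteq> 0" by (rule nonzero_obtain)
      obtain c where c: "elementary L c" "supp c \<subseteq> supp x" "c e = 1"
        using elementary_through[OF less.prems e] by blast
      define y where "y = (\<lambda>f. 1 * x f - x e * c f)"
      have yL: "y \<in> L" unfolding y_def using less.prems c by (intro comb_mem) (auto simp: elementary_def)
      have "supp y \<subseteq> supp x" "y e = 0" using c(2,3) by (auto simp: y_def supp_def)
      hence "supp y \<subset> supp x" using e by (auto simp: supp_def)
      hence "card (supp y) < card (supp x)" using finite_supp less.prems by (intro psubset_card_mono)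
      hence "y \<in> G" using less.hyps yL by blast
      moreover have "(\<lambda>f. - x e * c f) \<in> G" using subgroup_scale[OF assms(1,2) assms(3)[OF c(1)]] .
      moreover have "x = y - (\<lambda>f. - x e * c f)" by (auto simp: y_def)
      ultimately show ?thesis using assms(2) by metis
    qed (use assms(1) in simp)
  qed
qed

lemma deletion: "regular_lattice (E - {e}) {x \<in> L. x e = 0}"
proof
  fix x assume "x \<in> {x \<in> L. x e = 0}" "x \<noteq> 0"
  then obtain c where "c \<in> L" "c \<noteq> 0" "sign_part c x" using conformal_ex by blast
  then show "\<exists>c\<in>{x \<in> L. x e = 0}. c \<noteq> 0 \<and> sign_part c x"
    using supp_subsetD[OF sign_part_supp, of c x e] \<open>x \<in> {x \<in> L. x e = 0}\<close> by blast
qed (use finite_ground outside zero_mem diff_mem in auto)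

text \<open>The contraction of the coordinates outside \<open>D\<close>.\<close>
lemma projection: "regular_lattice E ((\<lambda>x f. if f \<in> D then x f else 0) ` L)"
proof
  let ?p = "\<lambda>x f. if f \<in> D then x f else (0 :: int)"
  show "0 \<in> ?p ` L" using zero_mem by (intro image_eqI[of _ _ 0]) auto
  show "x - y \<in> ?p ` L" if "x \<in> ?p ` L" "y \<in> ?p ` L" for x y
  proof -
    from that obtain x' y' where "x' \<in> L" "y' \<in> L" "x = ?p x'" "y = ?p y'" by blast
    thus ?thesis by (intro image_eqI[of _ _ "x' - y'"]) (auto intro: diff_mem)
  qed
  fix x assume "x \<in> ?p ` L" "x \<noteq> 0"
  then obtain y where y: "y \<in> L" "x = ?p y" by blast
  obtain e where "x e \<noteq> 0" using \<open>x \<noteq> 0\<close> by (rule nonzero_obtain)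
  hence e: "e \<in> D" "y e \<noteq> 0" using y by (auto split: if_splits)
  obtain c where c: "c \<in> L" "sign_part c y" "c e \<noteq> 0" using part_through[OF y(1) e(2)] by blast
  have "?p c e \<noteq> 0" using c e by simp
  hence "?p c \<noteq> 0" unfolding fun_eq_iff zero_fun_apply by blast
  moreover have "sign_part (?p c) x" using c(2) by (auto simp: sign_part_def y)
  ultimately show "\<exists>c\<in>?p ` L. c \<noteq> 0 \<and> sign_part c x" using c(1) by blast
qed (use finite_ground outside in auto)

lemma switching:
  assumes "\<And>e. s e \<in> {-1, 1 :: int}"
  shows "regular_lattice E ((\<lambda>x e. s e * x e) ` L)"
proof
  let ?p = "\<lambda>x e. s e * x e"
  have s0: "s e \<noteq> 0" for e using assms[of e] by auto
  show "0 \<in> ?p ` L" using zero_mem by (intro image_eqI[of _ _ 0]) auto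
  show "x - y \<in> ?p ` L" if "x \<in> ?p ` L" "y \<in> ?p ` L" for x y
  proof -
    from that obtain x' y' where "x' \<in> L" "y' \<in> L" "x = ?p x'" "y = ?p y'" by blast
    thus ?thesis by (intro image_eqI[of _ _ "x' - y'"]) (auto intro: diff_mem simp: algebra_simps)
  qed
  fix x assume "x \<in> ?p ` L" "x \<noteq> 0"
  then obtain y where y: "y \<in> L" "x = ?p y" by blast
  hence "y \<noteq> 0" using \<open>x \<noteq> 0\<close> by auto
  then obtain c where c: "c \<in> L" "c \<noteq> 0" "sign_part c y" using conformal_ex y by blast
  have "?p c \<noteq> 0" using c(2) s0 by (auto simp: fun_eq_iff)
  moreover have "sign_part (?p c) x"
    unfolding sign_part_def y(2)
  proof
    fix e show "s e * c e = 0 \<or> s e * c e = sgn (s e * y e)"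
      using c(3)[unfolded sign_part_def, rule_format, of e] assms[of e] by (auto simp: sgn_mult)
  qed
  ultimately show "\<exists>c\<in>?p ` L. c \<noteq> 0 \<and> sign_part c x" using c(1) by blast
qed (use finite_ground outside in auto)

end

section \<open>Isometries permute the coordinate functionals up to sign\<close>

lemma int_mult_unit_diff_nonpos:
  fixes a b :: int
  assumes "\<bar>b\<bar> \<le> 1" shows "a * (b - a) \<le> 0"
proof -
  consider "a = 0" | "a \<ge> 1" "b - a \<le> 0" | "a \<le> -1" "b - a \<ge> 0" using assms by linarith
  then show ?thesis by cases (auto simp: mult_le_0_iff)
qed

text \<open>
  An intrinsic description of the \<open>{-1, 0, 1}\<close>-valued flows. For integers \<open>a\<close> and \<open>b \<in> {-1, 0, 1}\<close>
  always \<open>a * (b - a) \<le> 0\<close>; if an entry of \<open>x\<close> has absolute value at least \<open>2\<close>, a conformal unit flow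
  through that entry violates the inequality.
\<close>
lemma (in regular_lattice) unit_iff_inner_product:
  assumes "x \<in> L"
  shows "(\<forall>e. \<bar>x e\<bar> \<le> 1) \<longleftrightarrow> (\<forall>y\<in>L. int_dot E y (x - y) \<le> 0)"
proof
  assume "\<forall>e. \<bar>x e\<bar> \<le> 1"
  then show "\<forall>y\<in>L. int_dot E y (x - y) \<le> 0"
    unfolding int_dot_def by (auto intro!: sum_nonpos int_mult_unit_diff_nonpos)
next
  assume le: "\<forall>y\<in>L. int_dot E y (x - y) \<le> 0"
  show "\<forall>e. \<bar>x e\<bar> \<le> 1"
  proof (rule ccontr)
    assume "\<not> (\<forall>e. \<bar>x e\<bar> \<le> 1)"
    then obtain e where "\<not> \<bar>x e\<bar> \<le> 1" by blast
    hence e: "\<bar>x e\<bar> \<ge> 2" by linarith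
    hence "x e \<noteq> 0" by auto
    then obtain c where c: "c \<in> L" "sign_part c x" "c e \<noteq> 0"
      using part_through assms by blast
    have c_sgn: "c f = 0 \<or> c f = sgn (x f)" for f using c(2) by (simp add: sign_part_def)
    have "c f * (x f - c f) \<ge> 0" for f
      using c_sgn[of f] by (auto simp: sgn_if)
    moreover have "c e * (x e - c e) > 0"
      using c_sgn[of e] c(3) e by (auto simp: sgn_if split: if_splits)
    moreover have "e \<in> E" using outside[OF assms] \<open>x e \<noteq> 0\<close> by blast
    ultimately have "int_dot E c (x - c) > 0"
      unfolding int_dot_def using finite_ground by (intro sum_pos2[of E e]) auto
    with le c(1) show False by fastforce
  qed
qed

lemma int_dot_self_unit: "(\<And>e. \<bar>x e\<bar> \<le> 1) \<Longrightarrow> int_dot E x x = norm1 E x"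
  unfolding int_dot_def norm1_def
proof (intro sum.cong refl)
  fix e assume "\<And>e. \<bar>x e\<bar> \<le> (1 :: int)"
  from this[of e] have "x e = 0 \<or> x e = 1 \<or> x e = -1" by linarith
  then show "x e * x e = \<bar>x e\<bar>" by auto
qed

lemma norm1_triangle: "norm1 E x \<le> norm1 E c + norm1 E (x - c)"
  unfolding norm1_def sum.distrib[symmetric] by (intro sum_mono) auto

text \<open>
  Decompose \<open>x\<close> into conformal unit flows. Their L1 norms add up to that of \<open>x\<close> and are squared
  lengths, hence they are kept by \<open>\<psi>\<close>, which maps unit flows to unit flows; now use the triangle
  inequality for the images.
\<close>
lemma isometry_norm1_le:
  assumes "regular_lattice E L" and "regular_lattice F K"
    and img: "\<psi> ` L = K"
    and hom: "\<And>x y. x \<in> L \<Longrightarrow> y \<in> L \<Longrightarrow> \<psi> (x - y) = \<psi> x - \<psi> y"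
    and ip: "\<And>x y. x \<in> L \<Longrightarrow> y \<in> L \<Longrightarrow> int_dot F (\<psi> x) (\<psi> y) = int_dot E x y"
    and "x \<in> L"
  shows "norm1 F (\<psi> x) \<le> norm1 E x"
proof -
  interpret L: regular_lattice E L by fact
  interpret K: regular_lattice F K by fact
  have unit: "norm1 F (\<psi> c) = norm1 E c" if c: "c \<in> L" "\<And>e. \<bar>c e\<bar> \<le> 1" for c
  proof -
    have "int_dot F y (\<psi> c - y) \<le> 0" if "y \<in> K" for y
    proof -
      obtain z where z: "z \<in> L" "y = \<psi> z" using img \<open>y \<in> K\<close> by blast
      have "int_dot E z (c - z) \<le> 0" using L.unit_iff_inner_product c z(1) by blast
      thus ?thesis using ip[OF z(1) L.diff_mem[OF c(1) z(1)]] hom[OF c(1) z(1)] z(2) by simp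
    qed
    hence "\<And>f. \<bar>\<psi> c f\<bar> \<le> 1" using K.unit_iff_inner_product[of "\<psi> c"] img c(1) by blast
    hence "norm1 F (\<psi> c) = int_dot F (\<psi> c) (\<psi> c)" by (rule int_dot_self_unit[symmetric])
    also have "\<dots> = norm1 E c" using ip c int_dot_self_unit by metis
    finally show ?thesis .
  qed
  have "\<psi> 0 = 0" using hom[OF L.zero_mem L.zero_mem] by simp
  show ?thesis using \<open>x \<in> L\<close>
  proof (induction "nat (norm1 E x)" arbitrary: x rule: less_induct)
    case less
    show ?case
    proof (cases "x = 0")
      case True
      thus ?thesis using \<open>\<psi> 0 = 0\<close> by (simp add: norm1_def)
    next
      case False
      then obtain c where c: "c \<in> L" "c \<noteq> 0" "sign_part c x" using L.conformal_ex less.prems by blast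
      have "\<bar>c e\<bar> \<le> 1" for e using sign_part_unit[OF c(3), of e] by auto
      hence eq: "norm1 F (\<psi> c) = norm1 E c" using unit c(1) by blast
      have sub: "norm1 E (x - c) = norm1 E x - norm1 E c" using c(3) by (rule norm1_diff_part)
      have xc: "x - c \<in> L" using L.diff_mem less.prems c(1) .
      have "nat (norm1 E (x - c)) < nat (norm1 E x)"
        using sub L.norm1_pos[OF c(1,2)] norm1_nonneg[of E "x - c"] by linarith
      hence "norm1 F (\<psi> (x - c)) \<le> norm1 E (x - c)" using less.hyps xc by blast
      moreover have "norm1 F (\<psi> x) \<le> norm1 F (\<psi> c) + norm1 F (\<psi> (x - c))"
        using norm1_triangle[of F "\<psi> x" "\<psi> c"] hom[OF less.prems c(1)] by simp
      ultimately show ?thesis using eq sub by linarith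
    qed
  qed
qed

lemma isometry_norm1:
  assumes L: "regular_lattice E L" and K: "regular_lattice F K"
    and bij: "bij_betw \<psi> L K"
    and hom: "\<And>x y. x \<in> L \<Longrightarrow> y \<in> L \<Longrightarrow> \<psi> (x - y) = \<psi> x - \<psi> y"
    and ip: "\<And>x y. x \<in> L \<Longrightarrow> y \<in> L \<Longrightarrow> int_dot F (\<psi> x) (\<psi> y) = int_dot E x y"
    and x: "x \<in> L"
  shows "norm1 F (\<psi> x) = norm1 E x"
proof (rule antisym)
  interpret L: regular_lattice E L by fact
  have img: "\<psi> ` L = K" and inj: "inj_on \<psi> L" using bij by (auto simp: bij_betw_def)
  show "norm1 F (\<psi> x) \<le> norm1 E x" by (rule isometry_norm1_le[OF L K img hom ip x])
  let ?i = "inv_into L \<psi>"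
  have i\<psi>: "?i (\<psi> u) = u" if "u \<in> L" for u using inj that by simp
  have "norm1 E (?i (\<psi> x)) \<le> norm1 F (\<psi> x)"
  proof (rule isometry_norm1_le[OF K L])
    show "?i ` K = L" using bij_betw_inv_into[OF bij] by (simp add: bij_betw_def)
    fix u v assume "u \<in> K" "v \<in> K"
    then obtain a b where ab: "a \<in> L" "b \<in> L" "u = \<psi> a" "v = \<psi> b" using img by blast
    show "?i (u - v) = ?i u - ?i v"
      using ab i\<psi> hom[OF ab(1,2)] L.diff_mem[OF ab(1,2)] by metis
    show "int_dot E (?i u) (?i v) = int_dot F u v" using ab i\<psi> ip by simp
  qed (use x img in blast)
  thus "norm1 E x \<le> norm1 F (\<psi> x)" using i\<psi> x by simp
qed

definition additive_on :: "('a \<Rightarrow> int) set \<Rightarrow> (('a \<Rightarrow> int) \<Rightarrow> int) \<Rightarrow> bool" where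
  "additive_on S h \<longleftrightarrow> (\<forall>x\<in>S. \<forall>y\<in>S. h (x - y) = h x - h y)"

definition agree_up_to_sign :: "'v set \<Rightarrow> ('v \<Rightarrow> int) \<Rightarrow> ('v \<Rightarrow> int) \<Rightarrow> bool" where
  "agree_up_to_sign S h l \<longleftrightarrow> (\<forall>u\<in>S. h u = l u) \<or> (\<forall>u\<in>S. h u = - l u)"

locale function_subgroup =
  fixes S :: "('a \<Rightarrow> int) set"
  assumes zero_in: "0 \<in> S" and diff_in: "x \<in> S \<Longrightarrow> y \<in> S \<Longrightarrow> x - y \<in> S"
begin

lemma scale_in: "x \<in> S \<Longrightarrow> (\<lambda>e. k * x e) \<in> S"
  by (rule subgroup_scale[OF zero_in diff_in])

lemma additive_zero: "additive_on S h \<Longrightarrow> h 0 = 0"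
  using zero_in unfolding additive_on_def by (metis diff_self)

lemma additive_scale:
  assumes h: "additive_on S h" and z: "z \<in> S"
  shows "h (\<lambda>e. k * z e) = k * h z"
proof (induction k rule: int_induct[where k = 0])
  case base
  then show ?case using additive_zero[OF h] by (simp add: zero_fun_def)
next
  case (step1 i)
  have "h z = h ((\<lambda>e. (i + 1) * z e) - (\<lambda>e. i * z e))"
    by (rule arg_cong[of _ _ h]) (auto simp: algebra_simps)
  also have "\<dots> = h (\<lambda>e. (i + 1) * z e) - h (\<lambda>e. i * z e)"
    using h scale_in[OF z] unfolding additive_on_def by blast
  finally show ?case using step1 by (simp add: algebra_simps)
next
  case (step2 i)
  have "h (\<lambda>e. (i - 1) * z e) = h ((\<lambda>e. i * z e) - z)"
    by (rule arg_cong[of _ _ h]) (auto simp: algebra_simps)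
  also have "\<dots> = h (\<lambda>e. i * z e) - h z"
    using h scale_in[OF z] z unfolding additive_on_def by blast
  finally show ?case using step2 by (simp add: algebra_simps)
qed

lemma additive_diff_scale:
  assumes h: "additive_on S h" and "x \<in> S" "z \<in> S"
  shows "h (x - (\<lambda>e. k * z e)) = h x - k * h z"
  using assms scale_in[OF assms(3), of k] additive_scale[OF h assms(3), of k]
  unfolding additive_on_def by simp

text \<open>
  A quantitative form of the fact that a group is not a finite union of kernels of nonzero
  functionals. If the new functional is small at \<open>x\<close>, add a multiple of an element where it does not
  vanish; the other values at \<open>x\<close> are chosen so large that they survive.
\<close>
lemma simultaneously_large:
  assumes "finite T" and "\<And>h. h \<in> T \<Longrightarrow> additive_on S h" and "\<And>h. h \<in> T \<Longrightarrow> \<exists>z\<in>S. h z \<noteq> 0"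
    and "B \<ge> 0"
  shows "\<exists>x\<in>S. \<forall>h\<in>T. \<bar>h x\<bar> \<ge> B"
  using assms
proof (induction T arbitrary: B rule: finite_induct)
  case empty
  then show ?case using zero_in by blast
next
  case (insert h T)
  obtain z where z: "z \<in> S" "h z \<noteq> 0" using insert.prems(2) by blast
  define M where "M = (\<Sum>g\<in>T. \<bar>g z\<bar>)"
  have M: "\<bar>g z\<bar> \<le> M" if "g \<in> T" for g
    unfolding M_def by (rule member_le_sum[OF that]) (use insert.hyps in auto)
  have "M \<ge> 0" unfolding M_def by (rule sum_nonneg) simp
  have "0 \<le> B + 2 * B * M" using \<open>M \<ge> 0\<close> insert.prems(3) by simp
  with insert.IH insert.prems(1,2) obtain x where x: "x \<in> S" "\<forall>g\<in>T. B + 2 * B * M \<le> \<bar>g x\<bar>"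
    by (metis insertCI)
  show ?case
  proof (cases "\<bar>h x\<bar> \<ge> B")
    case True
    have "0 \<le> 2 * B * M" using \<open>M \<ge> 0\<close> insert.prems(3) by simp
    with True x show ?thesis by (intro bexI[of _ x]) auto
  next
    case False
    define x' where "x' = x - (\<lambda>e. (- 2 * B) * z e)"
    have val: "g x' = g x + 2 * B * g z" if "g \<in> insert h T" for g
      unfolding x'_def additive_diff_scale[OF insert.prems(1)[OF that] x(1) z(1)] by simp
    have "B \<le> \<bar>g x'\<bar>" if g: "g \<in> T" for g
    proof -
      have "\<bar>2 * B * g z\<bar> = 2 * B * \<bar>g z\<bar>" using insert.prems(3) by (simp add: abs_mult)
      also have "\<dots> \<le> 2 * B * M" using M[OF g] insert.prems(3) by (intro mult_left_mono) auto
      finally show ?thesis using val[of g] g x(2) by force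
    qed
    moreover have "B \<le> \<bar>h x'\<bar>"
    proof -
      have "2 * B * 1 \<le> 2 * B * \<bar>h z\<bar>" using z(2) insert.prems(3) by (intro mult_left_mono) auto
      also have "\<dots> = \<bar>2 * B * h z\<bar>" using insert.prems(3) by (simp add: abs_mult)
      finally show ?thesis using val[of h] False by force
    qed
    moreover have "x' \<in> S" unfolding x'_def by (intro diff_in scale_in x(1) z(1))
    ultimately show ?thesis by blast
  qed
qed

text \<open>
  The second difference of \<open>\<bar>h\<bar>\<close> at \<open>x\<close> in direction \<open>y\<close> is zero as soon as \<open>\<bar>h x\<bar> \<ge> \<bar>h y\<bar>\<close>, and
  \<open>2 \<bar>h y\<bar>\<close> if \<open>h x = 0\<close>. Choosing \<open>x\<close> in the kernel of \<open>l\<close>, but far from the kernels of all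
  functionals that are not multiples of \<open>l\<close>, singles out the multiples of \<open>l\<close>. Those that take
  the value \<open>1\<close> are \<open>l\<close> and \<open>- l\<close>.
\<close>
lemma second_difference:
  assumes T: "finite T" and add: "\<And>h. h \<in> T \<Longrightarrow> additive_on S h"
    and prim: "\<And>h. h \<in> T \<Longrightarrow> (\<forall>u\<in>S. h u = 0) \<or> (\<exists>u\<in>S. h u = 1)"
    and l: "additive_on S l" and y: "y \<in> S" "l y = 1"
  shows "\<exists>x\<in>S. \<forall>h\<in>T. \<bar>h (x + y)\<bar> + \<bar>h (x - y)\<bar> - 2 * \<bar>h x\<bar>
    = (if agree_up_to_sign S h l then 2 else 0)"
proof -
  define S0 where "S0 = {u \<in> S. l u = 0}"
  define T0 where "T0 = {h \<in> T. \<exists>z\<in>S0. h z \<noteq> 0}"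
  interpret S0: function_subgroup S0
    using zero_in additive_zero[OF l] diff_in l
    by unfold_locales (auto simp: S0_def additive_on_def)
  have "S0 \<subseteq> S" by (auto simp: S0_def)
  have "\<exists>x\<in>S0. \<forall>h\<in>T0. (\<Sum>h\<in>T. \<bar>h y\<bar>) \<le> \<bar>h x\<bar>"
  proof (rule S0.simultaneously_large)
    show "additive_on S0 h" if "h \<in> T0" for h
      using add[of h] that \<open>S0 \<subseteq> S\<close> by (auto simp: T0_def additive_on_def)
  qed (use T in \<open>auto simp: T0_def intro: sum_nonneg\<close>)
  then obtain x where x: "x \<in> S" "l x = 0" and big: "\<And>h. h \<in> T0 \<Longrightarrow> (\<Sum>h\<in>T. \<bar>h y\<bar>) \<le> \<bar>h x\<bar>"
    by (auto simp: S0_def)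
  have "\<bar>h (x + y)\<bar> + \<bar>h (x - y)\<bar> - 2 * \<bar>h x\<bar> = (if agree_up_to_sign S h l then 2 else 0)"
    if h: "h \<in> T" for h
  proof -
    have xy: "x + y = x - (\<lambda>e. -1 * y e)" by (auto simp: fun_eq_iff)
    have plus: "h (x + y) = h x + h y"
      unfolding xy additive_diff_scale[OF add[OF h] x(1) y(1)] by simp
    have minus: "h (x - y) = h x - h y" using add[OF h] x y by (auto simp: additive_on_def)
    show ?thesis
    proof (cases "h \<in> T0")
      case True
      have "\<bar>h y\<bar> \<le> (\<Sum>h\<in>T. \<bar>h y\<bar>)" using h T by (intro member_le_sum) auto
      with big[OF True] have "\<bar>h y\<bar> \<le> \<bar>h x\<bar>" by simp
      moreover have "\<not> agree_up_to_sign S h l"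
        using True by (force simp: T0_def S0_def agree_up_to_sign_def)
      ultimately show ?thesis unfolding plus minus by auto
    next
      case False
      have rep: "h u = h y * l u" if u: "u \<in> S" for u
      proof -
        have "u - (\<lambda>e. l u * y e) \<in> S" by (intro diff_in scale_in u y(1))
        moreover have "l (u - (\<lambda>e. l u * y e)) = 0"
          unfolding additive_diff_scale[OF l u y(1)] y(2) by simp
        ultimately have "u - (\<lambda>e. l u * y e) \<in> S0" unfolding S0_def by blast
        hence "h (u - (\<lambda>e. l u * y e)) = 0" using False h unfolding T0_def by blast
        thus ?thesis unfolding additive_diff_scale[OF add[OF h] u y(1)] by simp
      qed
      have hx: "h x = 0" using rep[OF x(1)] x(2) by simp
      show ?thesis
      proof (cases "\<forall>u\<in>S. h u = 0")
        case True
        hence "\<not> agree_up_to_sign S h l" using y by (force simp: agree_up_to_sign_def)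
        thus ?thesis unfolding plus minus using True y(1) hx by simp
      next
        case False
        then obtain u where u: "u \<in> S" "h u = 1" using prim[OF h] by blast
        hence "h y * l u = 1" using rep by simp
        hence hy: "h y = 1 \<or> h y = -1" using zmult_eq_1_iff by blast
        hence "agree_up_to_sign S h l" using rep unfolding agree_up_to_sign_def by auto
        thus ?thesis unfolding plus minus hx using hy by auto
      qed
    qed
  qed
  with x(1) show ?thesis by blast
qed

text \<open>
  The function \<open>\<Sum>\<^sub>i \<bar>h\<^sub>i\<bar>\<close> determines how many \<open>h\<^sub>i\<close> equal \<open>l\<close> or \<open>- l\<close>: its second difference as in
  the preceding lemma is twice that number.
\<close>
lemma equal_multiplicities:
  fixes h :: "'i \<Rightarrow> ('a \<Rightarrow> int) \<Rightarrow> int" and k :: "'j \<Rightarrow> ('a \<Rightarrow> int) \<Rightarrow> int"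
  assumes I: "finite I" and J: "finite J"
    and add_h: "\<And>i. i \<in> I \<Longrightarrow> additive_on S (h i)" and add_k: "\<And>j. j \<in> J \<Longrightarrow> additive_on S (k j)"
    and prim_h: "\<And>i. i \<in> I \<Longrightarrow> (\<forall>u\<in>S. h i u = 0) \<or> (\<exists>u\<in>S. h i u = 1)"
    and prim_k: "\<And>j. j \<in> J \<Longrightarrow> (\<forall>u\<in>S. k j u = 0) \<or> (\<exists>u\<in>S. k j u = 1)"
    and eq: "\<And>u. u \<in> S \<Longrightarrow> (\<Sum>i\<in>I. \<bar>h i u\<bar>) = (\<Sum>j\<in>J. \<bar>k j u\<bar>)"
    and l: "additive_on S l" "\<exists>y\<in>S. l y = 1"
  shows "card {i \<in> I. agree_up_to_sign S (h i) l} = card {j \<in> J. agree_up_to_sign S (k j) l}"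
proof -
  obtain y where y: "y \<in> S" "l y = 1" using l(2) by blast
  define T where "T = h ` I \<union> k ` J"
  have "\<exists>x\<in>S. \<forall>g\<in>T. \<bar>g (x + y)\<bar> + \<bar>g (x - y)\<bar> - 2 * \<bar>g x\<bar> = (if agree_up_to_sign S g l then 2 else 0)"
  proof (rule second_difference[OF _ _ _ l(1) y])
    show "(\<forall>u\<in>S. g u = 0) \<or> (\<exists>u\<in>S. g u = 1)" if "g \<in> T" for g
      using that prim_h prim_k unfolding T_def by blast
  qed (use I J add_h add_k in \<open>auto simp: T_def\<close>)
  then obtain x where x: "x \<in> S"
    and sd: "\<And>g. g \<in> T \<Longrightarrow> \<bar>g (x + y)\<bar> + \<bar>g (x - y)\<bar> - 2 * \<bar>g x\<bar> = (if agree_up_to_sign S g l then 2 else 0)"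
    by blast
  have "x + y = x - (0 - y)" by simp
  hence xy: "x + y \<in> S" "x - y \<in> S" using x y zero_in diff_in by metis+
  have "2 * int (card {i \<in> I. agree_up_to_sign S (h i) l})
      = (\<Sum>i\<in>I. if agree_up_to_sign S (h i) l then 2 else 0)"
    using I by (simp add: sum.If_cases Int_def conj_commute)
  also have "\<dots> = (\<Sum>i\<in>I. \<bar>h i (x + y)\<bar> + \<bar>h i (x - y)\<bar> - 2 * \<bar>h i x\<bar>)"
    using sd by (intro sum.cong) (auto simp: T_def)
  also have "\<dots> = (\<Sum>i\<in>I. \<bar>h i (x + y)\<bar>) + (\<Sum>i\<in>I. \<bar>h i (x - y)\<bar>) - 2 * (\<Sum>i\<in>I. \<bar>h i x\<bar>)"
    by (simp add: sum.distrib sum_subtractf sum_distrib_left)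
  also have "\<dots> = (\<Sum>j\<in>J. \<bar>k j (x + y)\<bar>) + (\<Sum>j\<in>J. \<bar>k j (x - y)\<bar>) - 2 * (\<Sum>j\<in>J. \<bar>k j x\<bar>)"
    using eq[OF x] eq[OF xy(1)] eq[OF xy(2)] by simp
  also have "\<dots> = (\<Sum>j\<in>J. \<bar>k j (x + y)\<bar> + \<bar>k j (x - y)\<bar> - 2 * \<bar>k j x\<bar>)"
    by (simp add: sum.distrib sum_subtractf sum_distrib_left)
  also have "\<dots> = (\<Sum>j\<in>J. if agree_up_to_sign S (k j) l then 2 else 0)"
    using sd by (intro sum.cong) (auto simp: T_def)
  also have "\<dots> = 2 * int (card {j \<in> J. agree_up_to_sign S (k j) l})"
    using J by (simp add: sum.If_cases Int_def conj_commute)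
  finally show ?thesis by simp
qed

end

lemma bij_betw_of_equal_fibres:
  assumes "finite I" "finite J" and "\<And>q. card {i \<in> I. \<kappa> i = q} = card {j \<in> J. \<kappa>' j = q}"
  obtains \<beta> where "bij_betw \<beta> I J" "\<And>i. i \<in> I \<Longrightarrow> \<kappa>' (\<beta> i) = \<kappa> i"
proof -
  have "\<exists>b. bij_betw b {i \<in> I. \<kappa> i = q} {j \<in> J. \<kappa>' j = q}" for q
    using assms by (intro finite_same_card_bij) auto
  then obtain b where b: "\<And>q. bij_betw (b q) {i \<in> I. \<kappa> i = q} {j \<in> J. \<kappa>' j = q}" by metis
  define \<beta> where "\<beta> = (\<lambda>i. b (\<kappa> i) i)"
  have mem: "\<beta> i \<in> J \<and> \<kappa>' (\<beta> i) = \<kappa> i" if "i \<in> I" for i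
    using bij_betwE[OF b[of "\<kappa> i"]] that by (auto simp: \<beta>_def)
  have "inj_on \<beta> I"
  proof
    fix i i' assume i: "i \<in> I" "i' \<in> I" "\<beta> i = \<beta> i'"
    hence "\<kappa> i = \<kappa> i'" using mem by metis
    with i b[of "\<kappa> i"] show "i = i'" by (auto simp: bij_betw_def inj_on_def \<beta>_def)
  qed
  moreover have "j \<in> \<beta> ` I" if "j \<in> J" for j
  proof -
    have "j \<in> b (\<kappa>' j) ` {i \<in> I. \<kappa> i = \<kappa>' j}" using b[of "\<kappa>' j"] that by (auto simp: bij_betw_def)
    then obtain i where "i \<in> I" "\<kappa> i = \<kappa>' j" "j = b (\<kappa>' j) i" by blast
    thus ?thesis by (intro image_eqI[of _ _ i]) (simp_all add: \<beta>_def)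
  qed
  ultimately have "bij_betw \<beta> I J" using mem by (auto simp: bij_betw_def)
  with mem that show ?thesis by blast
qed

lemma (in regular_lattice) coordinate_primitive: "(\<forall>u\<in>L. u e = 0) \<or> (\<exists>u\<in>L. u e = 1)"
proof (cases "\<forall>u\<in>L. u e = 0")
  case False
  then obtain u where "u \<in> L" "u e \<noteq> 0" by blast
  then obtain c where "elementary L c" "c e = 1" by (rule elementary_through)
  thus ?thesis by (auto simp: elementary_def)
qed simp

text \<open>For the flows of a matroid, these are the elements that are not coloops.\<close>
definition active :: "('a \<Rightarrow> int) set \<Rightarrow> 'a set" where
  "active L = {e. \<exists>x\<in>L. x e \<noteq> 0}"

lemma inactive_zero: "x \<in> L \<Longrightarrow> e \<notin> active L \<Longrightarrow> x e = 0"
  unfolding active_def by blast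

lemma (in regular_lattice) active_subset: "active L \<subseteq> E"
  using outside unfolding active_def by blast

text \<open>
  The coordinates on \<open>L\<close> and the coordinates on \<open>K\<close> composed with \<open>\<psi>\<close> are two families of functionals
  on \<open>L\<close> whose absolute values have the same sum, the L1 norm. So each class of functionals up to
  sign contains equally many members of both families.
\<close>
lemma isometry_coordinate_matching:
  assumes L: "regular_lattice E L" and K: "regular_lattice F K"
    and bij: "bij_betw \<psi> L K"
    and hom: "\<And>x y. x \<in> L \<Longrightarrow> y \<in> L \<Longrightarrow> \<psi> (x - y) = \<psi> x - \<psi> y"
    and ip: "\<And>x y. x \<in> L \<Longrightarrow> y \<in> L \<Longrightarrow> int_dot F (\<psi> x) (\<psi> y) = int_dot E x y"
  obtains \<beta> where "bij_betw \<beta> (active L) (active K)"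
    "\<forall>e\<in>active L. agree_up_to_sign L (\<lambda>x. \<psi> x (\<beta> e)) (\<lambda>x. x e)"
proof -
  interpret L: regular_lattice E L by fact
  interpret K: regular_lattice F K by fact
  interpret S: function_subgroup L using L.zero_mem L.diff_mem by unfold_locales
  have img: "\<psi> ` L = K" using bij by (simp add: bij_betw_def)
  have active_L: "active L = {e \<in> E. \<exists>x\<in>L. x e \<noteq> 0}"
    using L.active_subset unfolding active_def by blast
  have active_K: "active K = {f \<in> F. \<exists>x\<in>L. \<psi> x f \<noteq> 0}"
    using K.active_subset unfolding active_def img[symmetric] by blast
  have add_e: "additive_on L (\<lambda>x. x e)" for e by (simp add: additive_on_def)
  have add_f: "additive_on L (\<lambda>x. \<psi> x f)" for f using hom by (simp add: additive_on_def)
  have prim_e: "(\<forall>u\<in>L. u e = 0) \<or> (\<exists>u\<in>L. u e = 1)" for e by (rule L.coordinate_primitive)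
  have prim_f: "(\<forall>u\<in>L. \<psi> u f = 0) \<or> (\<exists>u\<in>L. \<psi> u f = 1)" for f
    using K.coordinate_primitive[of f] img by blast
  \<comment> \<open>The unordered pair of \<open>h\<close> and \<open>- h\<close>, restricted to \<open>L\<close>: a name for the class of \<open>h\<close> up to sign.\<close>
  define key where "key = (\<lambda>h. {\<lambda>x. if x \<in> L then h x else (0 :: int), \<lambda>x. if x \<in> L then - h x else 0})"
  have key: "key h = key l \<longleftrightarrow> agree_up_to_sign L h l" for h l
    unfolding key_def agree_up_to_sign_def doubleton_eq_iff fun_eq_iff
    by (auto split: if_splits)
  have fibres: "card {e \<in> active L. key (\<lambda>x. x e) = q} = card {f \<in> active K. key (\<lambda>x. \<psi> x f) = q}" for q
  proof (cases "\<exists>l. additive_on L l \<and> (\<exists>y\<in>L. l y = 1) \<and> key l = q")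
    case True
    then obtain l where l: "additive_on L l" "\<exists>y\<in>L. l y = 1" and q: "q = key l" by blast
    have "card {e \<in> E. agree_up_to_sign L (\<lambda>x. x e) l} = card {f \<in> F. agree_up_to_sign L (\<lambda>x. \<psi> x f) l}"
      using isometry_norm1[OF L K bij hom ip]
      by (intro S.equal_multiplicities[OF L.finite_ground K.finite_ground add_e add_f prim_e prim_f _ l])
        (simp add: norm1_def)
    moreover have nz: "\<exists>u\<in>L. h u \<noteq> 0" if "agree_up_to_sign L h l" for h
    proof -
      obtain y where "y \<in> L" "l y = 1" using l(2) by blast
      with that have "h y = 1 \<or> h y = -1" by (auto simp: agree_up_to_sign_def)
      thus ?thesis using \<open>y \<in> L\<close> by (intro bexI[of _ y]) auto
    qed
    have "{e \<in> active L. key (\<lambda>x. x e) = q} = {e \<in> E. agree_up_to_sign L (\<lambda>x. x e) l}"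
      using nz unfolding q key active_L by blast
    moreover have "{f \<in> active K. key (\<lambda>x. \<psi> x f) = q} = {f \<in> F. agree_up_to_sign L (\<lambda>x. \<psi> x f) l}"
      using nz unfolding q key active_K by blast
    ultimately show ?thesis by simp
  next
    case False
    have "key (\<lambda>x. x e) \<noteq> q" if "e \<in> active L" for e
    proof -
      have "\<exists>u\<in>L. u e = 1" using prim_e[of e] that unfolding active_L by blast
      thus ?thesis using False add_e[of e] by blast
    qed
    hence 1: "{e \<in> active L. key (\<lambda>x. x e) = q} = {}" by blast
    have "key (\<lambda>x. \<psi> x f) \<noteq> q" if "f \<in> active K" for f
    proof -
      have "\<exists>u\<in>L. \<psi> u f = 1" using prim_f[of f] that unfolding active_K by blast
      thus ?thesis using False add_f[of f] by blast
    qed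
    hence 2: "{f \<in> active K. key (\<lambda>x. \<psi> x f) = q} = {}" by blast
    show ?thesis unfolding 1 2 by simp
  qed
  have "finite (active L)" "finite (active K)" using L.finite_ground K.finite_ground by (simp_all add: active_L active_K)
  then obtain \<beta> where \<beta>: "bij_betw \<beta> (active L) (active K)" "\<And>e. e \<in> active L \<Longrightarrow> key (\<lambda>x. \<psi> x (\<beta> e)) = key (\<lambda>x. x e)"
    using bij_betw_of_equal_fibres[of "active L" "active K" "\<lambda>e. key (\<lambda>x. x e)" "\<lambda>f. key (\<lambda>x. \<psi> x f)"] fibres by blast
  show ?thesis
    using that[of \<beta>] \<beta> unfolding key by simp
qed

section \<open>A regular lattice is determined up to signs by its supports\<close>

context regular_lattice
begin

text \<open>
  Connectivity by common circuits is transitive. The classical proof works: for a pair of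
  intersecting supports whose union is smallest, eliminate a common element \<open>p\<close> from both flows. The
  elementary flows through \<open>u\<close> and through \<open>v\<close> in the result meet the other sides of the pair, and one
  of the pairs that they form has a union smaller than before.
\<close>
lemma elementary_join:
  assumes "elementary L z1" "elementary L z2" and "z1 u \<noteq> 0" "z2 v \<noteq> 0" and "z1 p \<noteq> 0" "z2 p \<noteq> 0"
  shows "\<exists>z. elementary L z \<and> z u \<noteq> 0 \<and> z v \<noteq> 0"
  using assms
proof (induction "card (supp z1 \<union> supp z2)" arbitrary: z1 z2 p rule: less_induct)
  case less
  note el = less.prems(1,2)
  have mem: "z1 \<in> L" "z2 \<in> L" using el by (auto simp: elementary_def)
  have fin: "finite (supp z1 \<union> supp z2)" using mem finite_supp by simp
  have IH: "\<exists>z. elementary L z \<and> z u \<noteq> 0 \<and> z v \<noteq> 0"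
    if "elementary L w1" "elementary L w2" "w1 u \<noteq> 0" "w2 v \<noteq> 0" "w1 q \<noteq> 0" "w2 q \<noteq> 0"
      and "supp w1 \<union> supp w2 \<subset> supp z1 \<union> supp z2" for w1 w2 q
    using less.hyps[OF psubset_card_mono[OF fin that(7)] that(1-6)] .
  show ?case
  proof (cases "z2 u \<noteq> 0 \<or> z1 v \<noteq> 0")
    case True
    then show ?thesis using less.prems by blast
  next
    case False
    define x where "x = (\<lambda>f. z2 p * z1 f - z1 p * z2 f)"
    have xL: "x \<in> L" unfolding x_def using mem by (rule comb_mem)
    have xu: "x u \<noteq> 0" and xv: "x v \<noteq> 0" and xp: "x p = 0"
      using False less.prems by (auto simp: x_def)
    have xs: "supp x \<subseteq> supp z1 \<union> supp z2" by (auto simp: x_def supp_def)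
    obtain c where c: "elementary L c" "supp c \<subseteq> supp x" "c u = 1"
      by (rule elementary_through[OF xL xu])
    obtain d where d: "elementary L d" "supp d \<subseteq> supp x" "d v = 1"
      by (rule elementary_through[OF xL xv])
    have cp: "c p = 0" and dp: "d p = 0" using supp_subsetD[OF c(2) xp] supp_subsetD[OF d(2) xp] by auto
    have "\<not> supp c \<subseteq> supp z1"
      using el(1) c(1) cp less.prems(5) unfolding elementary_def by (metis supp_iff)
    then obtain g where g: "c g \<noteq> 0" "z1 g = 0" by (auto simp: supp_def)
    hence g2: "z2 g \<noteq> 0" using c(2) xs by (auto simp: supp_def)
    have "\<not> supp d \<subseteq> supp z2"
      using el(2) d(1) dp less.prems(6) unfolding elementary_def by (metis supp_iff)
    then obtain h where h: "d h \<noteq> 0" "z2 h = 0" by (auto simp: supp_def)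
    hence h1: "z1 h \<noteq> 0" using d(2) xs by (auto simp: supp_def)
    show ?thesis
    proof (cases "d g = 0")
      case True
      have "supp z1 \<union> supp d \<subset> supp z1 \<union> supp z2"
        using d(2) xs True g g2 by (auto simp: supp_def)
      thus ?thesis using IH[OF el(1) d(1) less.prems(3) _ h1 h(1)] d(3) by simp
    next
      case False
      have "supp c \<union> supp d \<subset> supp z1 \<union> supp z2"
        using c(2) d(2) xs cp dp less.prems(5) by (auto simp: supp_def)
      thus ?thesis using IH[OF c(1) d(1) _ _ g(1) False] c(3) d(3) by simp
    qed
  qed
qed

text \<open>
  Up to multiples, \<open>u\<close> is the only flow that vanishes at \<open>e\<close> and lives on the union of the two
  supports. If \<open>u\<close> agreed with \<open>y\<close> at \<open>f\<close> and disagreed at \<open>g\<close>, then \<open>y + u\<close> would be \<open>0\<close> at \<open>g\<close> and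
  \<open>\<plusminus>2\<close> at \<open>f\<close>; a unit flow below it through \<open>f\<close> would vanish at \<open>g\<close>, hence be an integer multiple
  of \<open>y + u\<close>, which contradicts the entry \<open>\<plusminus>2\<close>.
\<close>
lemma theta_constant_sign:
  assumes y: "y \<in> L" "y e = 1" "\<And>f. y f \<in> {-1, 0, 1}"
    and u: "u \<in> L" "u e = 0" and p: "u p \<in> {-1, 1}"
    and rank: "\<And>x. x \<in> L \<Longrightarrow> x e = 0 \<Longrightarrow> supp x \<subseteq> supp y \<union> supp u \<Longrightarrow> \<exists>m. x = (\<lambda>f. m * u f)"
    and f: "y f \<noteq> 0" "u f \<noteq> 0" and g: "y g \<noteq> 0" "u g \<noteq> 0"
  shows "u f * y f = u g * y g"
proof -
  have unit: "u h \<in> {-1, 0, 1}" for h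
  proof (cases "u h = 0")
    case False
    then obtain c where c: "c \<in> L" "sign_part c u" "c h \<noteq> 0" using part_through u(1) by blast
    have "supp c \<subseteq> supp u" using c(2) by (rule sign_part_supp)
    moreover have "c e = 0" using calculation u(2) by (rule supp_subsetD)
    ultimately obtain m where "c = (\<lambda>f. m * u f)" using rank[OF c(1)] by blast
    hence "c h = m * u h" by simp
    thus ?thesis using c(3) sign_part_unit[OF c(2), of h] by (auto simp: zmult_eq_1_iff zmult_eq_neg1_iff)
  qed simp
  have False if f: "u f * y f = 1" and g: "u g * y g = -1" for f g
  proof -
    have uf: "u f = y f" "y f \<in> {-1, 1}" and ug: "u g = - y g" "y g \<noteq> 0"
      using f g by (auto simp: zmult_eq_1_iff zmult_eq_neg1_iff)
    have xL: "y + u \<in> L" using y(1) u(1) by (rule add_mem)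
    moreover have "(y + u) f \<noteq> 0" using uf by auto
    ultimately obtain c where c: "c \<in> L" "sign_part c (y + u)" "c f \<noteq> 0" using part_through by blast
    have cs: "supp c \<subseteq> supp (y + u)" using c(2) by (rule sign_part_supp)
    have cg: "c g = 0" using cs by (rule supp_subsetD) (simp add: ug)
    define z where "z = (\<lambda>h. 1 * c h - c e * y h)"
    have "z \<in> L" unfolding z_def using c(1) y(1) by (rule comb_mem)
    moreover have "z e = 0" by (simp add: z_def y(2))
    moreover have "supp z \<subseteq> supp y \<union> supp u" using cs by (auto simp: z_def supp_def)
    ultimately obtain m where "z = (\<lambda>h. m * u h)" using rank by blast
    hence "1 * c h - c e * y h = m * u h" for h unfolding z_def by (rule fun_cong)
    hence c_eq: "c h = m * u h + c e * y h" for h by (metis diff_add_cancel mult_1)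
    have "m = c e" using c_eq[of g] cg ug by simp
    hence "c f = 2 * (c e * y f)" using c_eq[of f] uf by simp
    moreover have "c f = 1 \<or> c f = -1" using c(3) sign_part_unit[OF c(2), of f] by auto
    ultimately show False by presburger
  qed
  moreover have "u f * y f \<in> {-1, 1}" "u g * y g \<in> {-1, 1}"
    using unit[of f] unit[of g] y(3)[of f] y(3)[of g] assms(8-) by auto
  ultimately show ?thesis by (metis insertE singletonD)
qed

end

text \<open>Inclusion-minimal supports are determined by the sets that contain supports.\<close>
lemma elementary_transfer:
  assumes L: "regular_lattice E L" and K: "regular_lattice E K"
    and same: "\<And>X. carries_flow L X \<longleftrightarrow> carries_flow K X"
    and c: "elementary L c" "c e \<noteq> 0"
  obtains d where "elementary K d" "supp d = supp c" "d e = 1" "\<And>f. d f \<in> {-1, 0, 1}"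
proof -
  interpret K: regular_lattice E K by fact
  note dep = same[unfolded carries_flow_def]
  have full: "supp x = supp c" if x: "x \<in> K" "x \<noteq> 0" "supp x \<subseteq> supp c" for x
  proof -
    obtain w where "w \<in> L" "w \<noteq> 0" "supp w \<subseteq> supp x" using dep x(1,2) by blast
    thus ?thesis using c(1) x(3) unfolding elementary_def by blast
  qed
  obtain x where x: "x \<in> K" "x \<noteq> 0" "supp x \<subseteq> supp c"
    using dep[of "supp c"] c(1) unfolding elementary_def by blast
  hence xe: "x e \<noteq> 0" using full c(2) by (metis supp_iff)
  obtain d where d: "elementary K d" "supp d \<subseteq> supp x" "d e = 1" "\<And>f. d f \<in> {-1, 0, 1}"
    by (rule K.elementary_through[OF x(1) xe]) blast
  moreover have "supp d = supp c" using full[of d] d(1,2) x(3) by (auto simp: elementary_def)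
  ultimately show ?thesis using that by blast
qed

text \<open>
  The situation in the induction step of \<open>unique_signing\<close>: two regular lattices with the same
  deletion \<open>L0\<close> of \<open>e\<close>, and the two signings of a circuit through \<open>e\<close>, normalised at \<open>e\<close>.
\<close>
locale common_deletion = L: regular_lattice E L + K: regular_lattice E K
  for E :: "'a set" and L K +
  fixes e :: 'a and y y' :: "'a \<Rightarrow> int"
  assumes deletion_eq: "{x \<in> L. x e = 0} = {x \<in> K. x e = 0}"
    and y: "elementary L y" "y e = 1" "\<And>f. y f \<in> {-1, 0, 1}"
    and y': "elementary K y'" "y' e = 1" "\<And>f. y' f \<in> {-1, 0, 1}"
    and supp_eq: "supp y = supp y'"
begin

definition L0 :: "('a \<Rightarrow> int) set" where
  "L0 = {x \<in> L. x e = 0}"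

definition U :: "'a set" where
  "U = {f \<in> supp y. y f \<noteq> y' f}"

definition V :: "'a set" where
  "V = {f \<in> supp y. y f = y' f}"

text \<open>The projection onto the coordinates outside the circuit, that is, its contraction.\<close>
definition outer :: "('a \<Rightarrow> int) \<Rightarrow> 'a \<Rightarrow> int" where
  "outer x = (\<lambda>f. if f \<in> - supp y then x f else 0)"

lemma y_mem: "y \<in> L" and y'_mem: "y' \<in> K"
  using y(1) y'(1) by (auto simp: elementary_def)

lemma L0_eq: "L0 = {x \<in> K. x e = 0}"
  unfolding L0_def by (rule deletion_eq)

sublocale L0: regular_lattice "E - {e}" L0
  unfolding L0_def by (rule L.deletion)

lemma outer_lattice: "regular_lattice (E - {e}) (outer ` L0)"
  unfolding outer_def by (rule L0.projection)

lemma inside_zero: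
  assumes "x \<in> L0" "supp x \<subseteq> supp y" shows "x = 0"
proof (rule ccontr)
  assume "x \<noteq> 0"
  hence "supp x = supp y" using y(1) assms by (auto simp: elementary_def L0_def)
  moreover have "x e = 0" using assms(1) by (simp add: L0_def)
  ultimately show False using y(2) by (metis supp_iff zero_neq_one)
qed

text \<open>
  If \<open>u\<close> is elementary after contracting the circuit, then the circuit and \<open>u\<close> form a theta. So \<open>u\<close>
  has constant sign relative to \<open>y\<close> and relative to \<open>y'\<close>, which is impossible if \<open>u\<close> is nonzero both
  where \<open>y\<close> and \<open>y'\<close> agree and where they disagree.
\<close>
lemma outer_elementary_one_sided:
  assumes u: "u \<in> L0" and el: "elementary (outer ` L0) (outer u)" and unit: "\<And>f. outer u f \<in> {-1, 0, 1}"
  shows "(\<forall>f\<in>U. u f = 0) \<or> (\<forall>f\<in>V. u f = 0)"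
proof (rule ccontr)
  interpret outer: regular_lattice "E - {e}" "outer ` L0" by (rule outer_lattice)
  assume "\<not> ?thesis"
  then obtain f g where f: "f \<in> U" "u f \<noteq> 0" and g: "g \<in> V" "u g \<noteq> 0" by blast
  have "outer u \<noteq> 0" using el by (simp add: elementary_def)
  then obtain p where p: "outer u p \<noteq> 0" by (rule nonzero_obtain)
  hence up: "outer u p = u p" "p \<notin> supp y" by (auto simp: outer_def split: if_splits)
  hence p1: "u p \<in> {-1, 1}" using unit[of p] p by auto
  have rank: "\<exists>m. x = (\<lambda>f. m * u f)" if x: "x \<in> L0" "supp x \<subseteq> supp y \<union> supp u" for x
  proof -
    have sub: "supp (outer x) \<subseteq> supp (outer u)" using x(2) by (auto simp: supp_def outer_def)
    have scaled: "u p * outer x f = x p * outer u f" for f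
      using outer.elementary_multiple[OF el _ sub p, of f] x(1) up by (simp add: outer_def)
    define w where "w = (\<lambda>f. 1 * x f - (u p * x p) * u f)"
    have wL: "w \<in> L0" unfolding w_def using x(1) u by (rule L0.comb_mem)
    have "w f = 0" if "f \<notin> supp y" for f
    proof -
      have "u p * x f = x p * u f" using scaled[of f] that by (simp add: outer_def)
      hence "u p * (u p * x f) = u p * x p * u f" by simp
      thus ?thesis using p1 by (auto simp: w_def)
    qed
    hence "w = 0" using inside_zero[OF wL] by (auto simp: supp_def)
    hence "1 * x f - (u p * x p) * u f = 0" for f
      unfolding w_def by (metis zero_fun_apply)
    hence "x f = (u p * x p) * u f" for f by (metis eq_iff_diff_eq_0 mult_1)
    thus ?thesis by blast
  qed
  have uL: "u \<in> L" "u \<in> K" "u e = 0" using u L0_eq by (auto simp: L0_def)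
  have fg: "y f \<noteq> 0" "y g \<noteq> 0" "y' f \<noteq> 0" "y' g \<noteq> 0" "y f \<noteq> y' f" "y g = y' g"
    using f(1) g(1) supp_eq by (auto simp: U_def V_def supp_def)
  have "u f * y f = u g * y g"
    by (rule L.theta_constant_sign[OF y_mem y(2,3) uL(1,3) p1])
      (use rank f(2) g(2) fg in \<open>auto simp: L0_def\<close>)
  moreover have "u f * y' f = u g * y' g"
    by (rule K.theta_constant_sign[OF y'_mem y'(2,3) uL(2,3) p1])
      (use rank f(2) g(2) fg supp_eq in \<open>auto simp: L0_eq\<close>)
  ultimately have "u f * y f = u f * y' f" using fg(6) by simp
  thus False using f(2) fg(5) by simp
qed

text \<open>
  Split off flows that are elementary and conformal after contracting the circuit. Each is
  one-sided, and conformality outside the circuit keeps the two partial sums from cancelling there.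
\<close>
lemma one_sided_decomposition:
  assumes "x \<in> L0"
  shows "\<exists>a\<in>L0. \<exists>b\<in>L0. x = a + b \<and> (\<forall>f\<in>V. a f = 0) \<and> (\<forall>f\<in>U. b f = 0)
    \<and> (\<forall>f. f \<notin> supp y \<longrightarrow> \<bar>a f\<bar> + \<bar>b f\<bar> \<le> \<bar>x f\<bar>)"
  using assms
proof (induction "nat (norm1 (E - {e}) (outer x))" arbitrary: x rule: less_induct)
  case less
  interpret outer: regular_lattice "E - {e}" "outer ` L0" by (rule outer_lattice)
  show ?case
  proof (cases "outer x = 0")
    case True
    have "supp x \<subseteq> supp y"
    proof
      fix f assume "f \<in> supp x"
      moreover have "outer x f = 0" using True by simp
      ultimately show "f \<in> supp y" by (auto simp: outer_def supp_def split: if_splits)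
    qed
    hence "x = 0" using inside_zero less.prems by blast
    thus ?thesis using L0.zero_mem by (intro bexI[of _ 0]) auto
  next
    case False
    then obtain c where c: "elementary (outer ` L0) c" "sign_part c (outer x)"
      using outer.elementary_part less.prems by blast
    then obtain u where u: "u \<in> L0" "c = outer u" by (auto simp: elementary_def)
    have unit: "outer u f \<in> {-1, 0, 1}" for f using sign_part_unit[OF c(2)] u(2) by simp
    have "outer (x - u) = outer x - outer u" by (auto simp: outer_def)
    moreover have "c \<in> outer ` L0" "c \<noteq> 0" using c(1) by (auto simp: elementary_def)
    ultimately have "norm1 (E - {e}) (outer (x - u)) < norm1 (E - {e}) (outer x)"
      using norm1_diff_part[OF c(2)] outer.norm1_pos[of c] u(2) by simp
    hence "nat (norm1 (E - {e}) (outer (x - u))) < nat (norm1 (E - {e}) (outer x))"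
      using norm1_nonneg[of "E - {e}" "outer (x - u)"] by linarith
    moreover have "x - u \<in> L0" using less.prems u(1) by (rule L0.diff_mem)
    ultimately obtain a b where ab: "a \<in> L0" "b \<in> L0" "x - u = a + b" "\<forall>f\<in>V. a f = 0" "\<forall>f\<in>U. b f = 0"
      and le: "\<And>f. f \<notin> supp y \<Longrightarrow> \<bar>a f\<bar> + \<bar>b f\<bar> \<le> \<bar>x f - u f\<bar>"
      using less.hyps[of "x - u"] by auto
    have le': "\<bar>a f\<bar> + \<bar>b f\<bar> + \<bar>u f\<bar> \<le> \<bar>x f\<bar>" if "f \<notin> supp y" for f
    proof -
      have "\<bar>outer x f - c f\<bar> = \<bar>outer x f\<bar> - \<bar>c f\<bar>" using sign_part_abs_diff[OF c(2)] .
      hence "\<bar>x f - u f\<bar> = \<bar>x f\<bar> - \<bar>u f\<bar>" using that by (simp add: u(2) outer_def)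
      with le[OF that] show ?thesis by simp
    qed
    have x_eq: "x = a + b + u" using ab(3) by (metis diff_add_cancel)
    consider "\<forall>f\<in>V. u f = 0" | "\<forall>f\<in>U. u f = 0"
      using outer_elementary_one_sided[OF u(1) _ unit] c(1) u(2) by blast
    thus ?thesis
    proof cases
      case 1
      have "\<bar>(a + u) f\<bar> + \<bar>b f\<bar> \<le> \<bar>x f\<bar>" if "f \<notin> supp y" for f
        using le'[OF that] abs_triangle_ineq[of "a f" "u f"] by simp
      moreover have "x = (a + u) + b" using x_eq by (simp add: add_ac)
      moreover have "\<forall>f\<in>V. (a + u) f = 0" using 1 ab(4) by simp
      ultimately show ?thesis using ab(2,5) L0.add_mem[OF ab(1) u(1)] by blast
    next
      case 2
      have "\<bar>a f\<bar> + \<bar>(b + u) f\<bar> \<le> \<bar>x f\<bar>" if "f \<notin> supp y" for f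
        using le'[OF that] abs_triangle_ineq[of "b f" "u f"] by simp
      moreover have "x = a + (b + u)" using x_eq by (simp add: add_ac)
      moreover have "\<forall>f\<in>U. (b + u) f = 0" using 2 ab(5) by simp
      ultimately show ?thesis using ab(1,4) L0.add_mem[OF ab(2) u(1)] by blast
    qed
  qed
qed

text \<open>
  For an elementary flow the decomposition must be trivial: its part \<open>a\<close> has support inside \<open>supp z\<close>,
  hence equal to it, but \<open>a\<close> vanishes on \<open>V\<close>.
\<close>
lemma elementary_one_sided:
  assumes z: "elementary L0 z" and f: "f \<in> U" "z f \<noteq> 0" and g: "g \<in> V"
  shows "z g = 0"
proof -
  have "z \<in> L0" using z by (simp add: elementary_def)
  then obtain a b where ab: "a \<in> L0" "b \<in> L0" "z = a + b" "\<forall>f\<in>V. a f = 0" "\<forall>f\<in>U. b f = 0"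
    and le: "\<And>f. f \<notin> supp y \<Longrightarrow> \<bar>a f\<bar> + \<bar>b f\<bar> \<le> \<bar>z f\<bar>"
    using one_sided_decomposition by blast
  have "supp a \<subseteq> supp z"
  proof
    fix h assume h: "h \<in> supp a"
    show "h \<in> supp z"
    proof (cases "h \<in> supp y")
      case True
      hence "h \<in> U" using h ab(4) by (auto simp: U_def V_def supp_def)
      thus ?thesis using h ab(3,5) by (simp add: supp_def)
    next
      case False
      from le[OF this] h show ?thesis by (auto simp: supp_def)
    qed
  qed
  moreover have "a f \<noteq> 0" using f ab(3,5) by simp
  hence "a \<noteq> 0" by auto
  ultimately have "supp a = supp z" using z ab(1) by (auto simp: elementary_def)
  thus ?thesis using ab(4) g by (metis supp_iff)
qed

lemma signing_exists: "\<exists>s. (\<forall>f. s f \<in> {-1, 1}) \<and> K = (\<lambda>x f. s f * x f) ` L"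
proof -
  \<comment> \<open>The union of the connected components of the deletion that meet \<open>U\<close>, together with \<open>U\<close>.\<close>
  define P where "P = U \<union> {g. \<exists>z. elementary L0 z \<and> (\<exists>f\<in>U. z f \<noteq> 0) \<and> z g \<noteq> 0}"
  define s where "s = (\<lambda>f. if f \<in> P then -1 else (1 :: int))"
  define sw where "sw = (\<lambda>x f. s f * x f :: int)"
  have s1: "s f \<in> {-1, 1}" for f by (simp add: s_def)
  have sw_sw: "sw (sw x) = x" for x by (auto simp: sw_def s_def)
  have PV: "f \<notin> P" if "f \<in> V" for f
    using that elementary_one_sided unfolding P_def U_def V_def by blast
  have sy: "sw y = y'"
  proof
    fix f
    consider "f \<in> U" | "f \<in> V" | "f \<notin> supp y" by (auto simp: U_def V_def)
    thus "sw y f = y' f"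
    proof cases
      case 1
      hence "f \<in> P" by (simp add: P_def)
      moreover have "y f = - y' f"
        using 1 y(3)[of f] y'(3)[of f] supp_eq by (auto simp: U_def supp_def)
      ultimately show ?thesis by (simp add: sw_def s_def)
    next
      case 2
      thus ?thesis using PV[OF 2] by (simp add: sw_def s_def V_def)
    next
      case 3
      moreover from this have "f \<notin> supp y'" using supp_eq by simp
      ultimately show ?thesis by (simp add: sw_def supp_def)
    qed
  qed
  have closed: "g \<in> P" if c: "elementary L0 c" "c p \<noteq> 0" "p \<in> P" "c g \<noteq> 0" for c p g
  proof (cases "p \<in> U")
    case True
    thus ?thesis using c unfolding P_def by blast
  next
    case False
    then obtain z f where "elementary L0 z" "f \<in> U" "z f \<noteq> 0" "z p \<noteq> 0" using c(3) unfolding P_def by blast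
    thus ?thesis using L0.elementary_join[of z c f g p] c unfolding P_def by blast
  qed
  have sw_L0: "L0 \<subseteq> {x. sw x \<in> L0}"
  proof (rule L0.elementary_generate)
    show "0 \<in> {x. sw x \<in> L0}" using L0.zero_mem by (simp add: sw_def zero_fun_def)
    show "x - x' \<in> {x. sw x \<in> L0}" if "x \<in> {x. sw x \<in> L0}" "x' \<in> {x. sw x \<in> L0}" for x x'
    proof -
      have "sw (x - x') = sw x - sw x'" by (auto simp: sw_def algebra_simps)
      thus ?thesis using that L0.diff_mem by simp
    qed
    fix c assume c: "elementary L0 c"
    hence cL: "c \<in> L0" by (simp add: elementary_def)
    show "c \<in> {x. sw x \<in> L0}"
    proof (cases "\<exists>p\<in>P. c p \<noteq> 0")
      case True
      hence "c g \<noteq> 0 \<Longrightarrow> g \<in> P" for g using closed[OF c] by blast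
      hence "sw c = - c" by (auto simp: sw_def s_def fun_eq_iff)
      thus ?thesis using L0.uminus_mem[OF cL] by simp
    next
      case False
      hence "sw c = c" by (auto simp: sw_def s_def fun_eq_iff)
      thus ?thesis using cL by simp
    qed
  qed
  \<comment> \<open>Stated for a pair \<open>N, N'\<close> because it is used for \<open>L, K\<close> and for \<open>K, L\<close>.\<close>
  have half: "sw x \<in> N'" if N: "regular_lattice E N" "regular_lattice E N'"
    and L0N: "L0 = {x \<in> N. x e = 0}" "L0 = {x \<in> N'. x e = 0}"
    and b: "b \<in> N" "b e = 1" "sw b \<in> N'" and x: "x \<in> N" for N N' b x
  proof -
    interpret N: regular_lattice E N by fact
    interpret N': regular_lattice E N' by fact
    define r where "r = (\<lambda>f. 1 * x f - x e * b f)"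
    have "r \<in> N" unfolding r_def using x b(1) by (rule N.comb_mem)
    moreover have "r e = 0" by (simp add: r_def b(2))
    ultimately have "r \<in> L0" using L0N(1) by simp
    hence "sw r \<in> N'" using sw_L0 L0N(2) by blast
    moreover have "(\<lambda>f. x e * sw b f) \<in> N'" using b(3) by (rule N'.scale_mem)
    moreover have "sw x = sw r + (\<lambda>f. x e * sw b f)" by (auto simp: sw_def r_def algebra_simps)
    ultimately show ?thesis using N'.add_mem by simp
  qed
  have LK: "sw x \<in> K" if "x \<in> L" for x
    by (rule half[OF L.regular_lattice_axioms K.regular_lattice_axioms L0_def L0_eq y_mem y(2) _ that])
      (simp add: sy y'_mem)
  have KL: "sw x \<in> L" if "x \<in> K" for x
    by (rule half[OF K.regular_lattice_axioms L.regular_lattice_axioms L0_eq L0_def y'_mem y'(2) _ that])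
      (simp add: sy[symmetric] sw_sw y_mem)
  have "K = sw ` L"
  proof
    show "K \<subseteq> sw ` L" using KL sw_sw by (metis image_eqI subsetI)
    show "sw ` L \<subseteq> K" using LK by blast
  qed
  thus ?thesis using s1 unfolding sw_def by blast
qed

end

text \<open>
  Uniqueness of regular representations up to scaling by signs, by induction on the coordinates. First
  switch signs in \<open>K\<close> so that the deletions of \<open>e\<close> coincide. If all flows vanish at \<open>e\<close>, in one lattice
  and hence in both, this is already the claim; otherwise there are two signings of a circuit
  through \<open>e\<close> to compare.
\<close>
theorem unique_signing:
  assumes "finite E"
    and "regular_lattice E L" and "regular_lattice E K"
    and "\<And>X. carries_flow L X \<longleftrightarrow> carries_flow K X"
  shows "\<exists>s. (\<forall>e. s e \<in> {-1, 1}) \<and> K = (\<lambda>x e. s e * x e) ` L"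
  using assms
proof (induction E arbitrary: L K rule: finite_induct)
  case empty
  interpret L: regular_lattice "{}" L by fact
  interpret K: regular_lattice "{}" K by fact
  have "L = {0}" "K = {0}"
    using L.zero_mem L.outside K.zero_mem K.outside by (auto simp: fun_eq_iff)
  thus ?case by (intro exI[of _ "\<lambda>_. 1"]) (simp add: zero_fun_def)
next
  case (insert e E)
  interpret L: regular_lattice "insert e E" L by fact
  interpret K: regular_lattice "insert e E" K by fact
  note dep = insert.prems(3)[unfolded carries_flow_def]
  have E: "insert e E - {e} = E" using insert.hyps by simp
  have supp_avoid: "x e = 0 \<and> supp x \<subseteq> X \<longleftrightarrow> supp x \<subseteq> X - {e}" for x :: "'a \<Rightarrow> int" and X
    by (auto simp: supp_def)
  have dep0: "carries_flow {x \<in> L. x e = 0} X \<longleftrightarrow> carries_flow {x \<in> K. x e = 0} X" for X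
    unfolding carries_flow_def using dep[of "X - {e}"] supp_avoid by blast
  obtain s0 where s0: "\<And>f. s0 f \<in> {-1, 1 :: int}"
    and K0: "{x \<in> K. x e = 0} = (\<lambda>x f. s0 f * x f) ` {x \<in> L. x e = 0}"
    using insert.IH[OF L.deletion[of e, unfolded E] K.deletion[of e, unfolded E] dep0] by blast
  define K' where "K' = (\<lambda>x f. s0 f * x f) ` K"
  interpret K': regular_lattice "insert e E" K' unfolding K'_def using s0 by (rule K.switching)
  have s0_sq: "s0 f * (s0 f * a) = a" for f a using s0[of f] by auto
  have s0_nz: "s0 f \<noteq> 0" for f using s0[of f] by auto
  have sw_supp: "supp (\<lambda>f. s0 f * x f) = supp x" for x using s0_nz by (simp add: supp_def)
  have sw_nz: "(\<lambda>f. s0 f * x f) = 0 \<longleftrightarrow> x = 0" for x using s0_nz by (simp add: fun_eq_iff)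
  have K_eq: "K = (\<lambda>x f. s0 f * x f) ` K'" by (simp add: K'_def image_image s0_sq)
  have "{x \<in> K'. x e = 0} = (\<lambda>x f. s0 f * x f) ` {x \<in> K. x e = 0}"
    using s0_nz[of e] unfolding K'_def by auto
  hence del: "{x \<in> L. x e = 0} = {x \<in> K'. x e = 0}" unfolding K0 by (simp add: image_image s0_sq)
  have dep': "carries_flow L X \<longleftrightarrow> carries_flow K' X" for X
    unfolding carries_flow_def dep K'_def by (simp add: sw_supp sw_nz)
  have "\<exists>s. (\<forall>f. s f \<in> {-1, 1}) \<and> K' = (\<lambda>x f. s f * x f) ` L"
  proof (cases "\<exists>x\<in>L. x e \<noteq> 0")
    case True
    then obtain x where x: "x \<in> L" "x e \<noteq> 0" by blast
    obtain y where y: "elementary L y" "y e = 1" "\<And>f. y f \<in> {-1, 0, 1}"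
      by (rule L.elementary_through[OF x]) blast
    have "y e \<noteq> 0" using y(2) by simp
    then obtain y' where y': "elementary K' y'" "supp y' = supp y" "y' e = 1" "\<And>f. y' f \<in> {-1, 0, 1}"
      using elementary_transfer[OF L.regular_lattice_axioms K'.regular_lattice_axioms dep' y(1)] by blast
    interpret common_deletion "insert e E" L K' e y y'
      using del y y' by unfold_locales auto
    show ?thesis by (rule signing_exists)
  next
    case False
    have "\<forall>x\<in>K'. x e = 0"
    proof (rule ccontr)
      assume "\<not> (\<forall>x\<in>K'. x e = 0)"
      then obtain x where x: "x \<in> K'" "x e \<noteq> 0" by blast
      obtain c where c: "elementary K' c" "c e = 1" by (rule K'.elementary_through[OF x]) blast
      have "c e \<noteq> 0" using c(2) by simp
      then obtain d where "elementary L d" "d e = 1"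
        using elementary_transfer[OF K'.regular_lattice_axioms L.regular_lattice_axioms dep'[symmetric] c(1)] by blast
      with False show False by (auto simp: elementary_def)
    qed
    with False del have "K' = L" by blast
    thus ?thesis by (intro exI[of _ "\<lambda>_. 1"]) simp
  qed
  then obtain s where s: "\<And>f. s f \<in> {-1, 1}" "K' = (\<lambda>x f. s f * x f) ` L" by blast
  have "K = (\<lambda>x f. (s0 f * s f) * x f) ` L"
    unfolding K_eq s(2) by (simp add: image_image mult.assoc)
  moreover have "s0 f * s f \<in> {-1, 1}" for f using s0[of f] s(1)[of f] by auto
  ultimately show ?case by (intro exI[of _ "\<lambda>f. s0 f * s f"]) blast
qed

section \<open>Isometries correspond to bijections that preserve supports of flows\<close>

definition int_isometry ::
  "'a set \<Rightarrow> ('a \<Rightarrow> int) set \<Rightarrow> 'b set \<Rightarrow> ('b \<Rightarrow> int) set \<Rightarrow> (('a \<Rightarrow> int) \<Rightarrow> 'b \<Rightarrow> int) \<Rightarrow> bool" where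
  "int_isometry E L F K \<psi> \<longleftrightarrow> bij_betw \<psi> L K
     \<and> (\<forall>x\<in>L. \<forall>y\<in>L. \<psi> (x - y) = \<psi> x - \<psi> y)
     \<and> (\<forall>x\<in>L. \<forall>y\<in>L. int_dot F (\<psi> x) (\<psi> y) = int_dot E x y)"

lemma (in regular_lattice) restrict_to_active: "regular_lattice (active L) L"
  using finite_subset[OF active_subset finite_ground] zero_mem diff_mem conformal_ex
  by unfold_locales (auto simp: active_def)

text \<open>
  If the coordinate \<open>\<beta> e\<close> of \<open>\<psi> x\<close> is the coordinate \<open>e\<close> of \<open>x\<close> up to sign, then \<open>\<beta>\<close> maps the support
  of \<open>x\<close> onto the support of \<open>\<psi> x\<close>.
\<close>
lemma flow_bijection_of_isometry:
  assumes L: "regular_lattice E L" and K: "regular_lattice F K" and \<psi>: "int_isometry E L F K \<psi>"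
  obtains \<beta> where "bij_betw \<beta> (active L) (active K)"
    "\<forall>X. X \<subseteq> active L \<longrightarrow> (carries_flow L X \<longleftrightarrow> carries_flow K (\<beta> ` X))"
proof -
  interpret L: regular_lattice E L by fact
  interpret K: regular_lattice F K by fact
  have bij: "bij_betw \<psi> L K"
    and hom: "\<And>x y. x \<in> L \<Longrightarrow> y \<in> L \<Longrightarrow> \<psi> (x - y) = \<psi> x - \<psi> y"
    and ip: "\<And>x y. x \<in> L \<Longrightarrow> y \<in> L \<Longrightarrow> int_dot F (\<psi> x) (\<psi> y) = int_dot E x y"
    using \<psi> by (auto simp: int_isometry_def)
  have img: "\<psi> ` L = K" using bij by (simp add: bij_betw_def)
  obtain \<beta> where \<beta>: "bij_betw \<beta> (active L) (active K)"
    and signs: "\<forall>e\<in>active L. agree_up_to_sign L (\<lambda>x. \<psi> x (\<beta> e)) (\<lambda>x. x e)"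
    using isometry_coordinate_matching[OF L K bij hom ip] by blast
  have agree: "\<psi> x (\<beta> e) = 0 \<longleftrightarrow> x e = 0" if "e \<in> active L" "x \<in> L" for e x
    using bspec[OF signs that(1)] that(2) unfolding agree_up_to_sign_def by fastforce
  have sub: "supp (\<psi> x) \<subseteq> \<beta> ` X \<longleftrightarrow> supp x \<subseteq> X" if x: "x \<in> L" and X: "X \<subseteq> active L" for x X
  proof
    assume s: "supp (\<psi> x) \<subseteq> \<beta> ` X"
    show "supp x \<subseteq> X"
    proof
      fix e assume "e \<in> supp x"
      hence e: "e \<in> active L" "x e \<noteq> 0" using x by (auto simp: active_def supp_def)
      hence "\<beta> e \<in> \<beta> ` X" using agree[OF e(1) x] s by (auto simp: supp_def)
      thus "e \<in> X" using \<beta> e(1) X by (auto simp: bij_betw_def inj_on_def)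
    qed
  next
    assume s: "supp x \<subseteq> X"
    show "supp (\<psi> x) \<subseteq> \<beta> ` X"
    proof
      fix f assume f: "f \<in> supp (\<psi> x)"
      hence "f \<in> active K" using x img by (auto simp: active_def supp_def)
      then obtain e where e: "e \<in> active L" "f = \<beta> e" using \<beta> by (auto simp: bij_betw_def)
      hence "x e \<noteq> 0" using agree[OF e(1) x] f by (auto simp: supp_def)
      thus "f \<in> \<beta> ` X" using s e by (auto simp: supp_def)
    qed
  qed
  have "\<psi> 0 = 0" using hom[OF L.zero_mem L.zero_mem] by simp
  hence nz: "\<psi> x = 0 \<longleftrightarrow> x = 0" if "x \<in> L" for x
    using bij L.zero_mem that by (metis bij_betw_def inj_onD)
  have "carries_flow L X \<longleftrightarrow> carries_flow K (\<beta> ` X)" if "X \<subseteq> active L" for X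
    unfolding carries_flow_def img[symmetric] using sub[OF _ that] nz by auto
  with \<beta> that show ?thesis by blast
qed

definition pullback :: "'a set \<Rightarrow> ('a \<Rightarrow> 'b) \<Rightarrow> ('b \<Rightarrow> int) \<Rightarrow> 'a \<Rightarrow> int" where
  "pullback E \<beta> x = (\<lambda>e. if e \<in> E then x (\<beta> e) else 0)"

lemma regular_lattice_pullback:
  assumes K: "regular_lattice F K" and \<beta>: "bij_betw \<beta> E F"
  shows "regular_lattice E (pullback E \<beta> ` K)"
proof
  interpret K: regular_lattice F K by fact
  show "finite E" using \<beta> K.finite_ground bij_betw_finite by blast
  show "0 \<in> pullback E \<beta> ` K"
    using K.zero_mem by (intro image_eqI[of _ _ 0]) (auto simp: pullback_def)
  show "x - y \<in> pullback E \<beta> ` K" if "x \<in> pullback E \<beta> ` K" "y \<in> pullback E \<beta> ` K" for x y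
  proof -
    from that obtain x' y' where "x' \<in> K" "y' \<in> K" "x = pullback E \<beta> x'" "y = pullback E \<beta> y'" by blast
    thus ?thesis
      by (intro image_eqI[of _ _ "x' - y'"]) (auto simp: pullback_def intro: K.diff_mem)
  qed
  show "x e = 0" if "x \<in> pullback E \<beta> ` K" "e \<notin> E" for x e using that by (auto simp: pullback_def)
  fix x assume "x \<in> pullback E \<beta> ` K" "x \<noteq> 0"
  then obtain y where y: "y \<in> K" "x = pullback E \<beta> y" by blast
  hence "y \<noteq> 0" using \<open>x \<noteq> 0\<close> by (auto simp: pullback_def)
  then obtain c where c: "c \<in> K" "c \<noteq> 0" "sign_part c y" using K.conformal_ex y(1) by blast
  obtain f where f: "c f \<noteq> 0" using c(2) by (rule nonzero_obtain)
  hence "f \<in> F" using K.outside c(1) by blast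
  then obtain e where "e \<in> E" "f = \<beta> e" using \<beta> by (auto simp: bij_betw_def)
  hence "pullback E \<beta> c e \<noteq> 0" using f by (simp add: pullback_def)
  hence "pullback E \<beta> c \<noteq> 0" by auto
  moreover have "sign_part (pullback E \<beta> c) x"
    using c(3) by (auto simp: sign_part_def y(2) pullback_def)
  ultimately show "\<exists>c\<in>pullback E \<beta> ` K. c \<noteq> 0 \<and> sign_part c x" using c(1) by blast
qed

text \<open>
  Pulled back along \<open>\<beta>\<close>, the lattice \<open>K\<close> becomes a regular lattice on the active coordinates of \<open>L\<close> that
  is supported on the same sets. So it arises from \<open>L\<close> by sign changes, which are isometries.
\<close>
lemma isometry_of_flow_bijection:
  assumes L: "regular_lattice E L" and K: "regular_lattice F K"
    and \<beta>: "bij_betw \<beta> (active L) (active K)"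
    and same: "\<And>X. X \<subseteq> active L \<Longrightarrow> carries_flow L X \<longleftrightarrow> carries_flow K (\<beta> ` X)"
  shows "\<exists>\<psi>. int_isometry E L F K \<psi>"
proof -
  interpret L: regular_lattice E L by fact
  interpret K: regular_lattice F K by fact
  define A where "A = active L"
  define p where "p = pullback A \<beta>"
  interpret LA: regular_lattice A L unfolding A_def by (rule L.restrict_to_active)
  interpret P: regular_lattice A "p ` K"
    unfolding p_def A_def by (rule regular_lattice_pullback[OF K.restrict_to_active \<beta>])
  have \<beta>A: "\<beta> ` A = active K" and \<beta>_inj: "inj_on \<beta> A" using \<beta> by (auto simp: A_def bij_betw_def)
  have p_inj: "inj_on p K"
  proof
    fix x y assume xy: "x \<in> K" "y \<in> K" "p x = p y"
    show "x = y"
    proof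
      fix f show "x f = y f"
      proof (cases "f \<in> active K")
        case True
        then obtain e where e: "e \<in> A" "f = \<beta> e" using \<beta>A by blast
        from fun_cong[OF xy(3), of e] e show ?thesis by (simp add: p_def pullback_def)
      next
        case False
        thus ?thesis using inactive_zero[OF xy(1)] inactive_zero[OF xy(2)] by simp
      qed
    qed
  qed
  have p_zero: "p x = 0 \<longleftrightarrow> x = 0" if "x \<in> K" for x
  proof -
    have "p 0 = 0" by (auto simp: p_def pullback_def)
    thus ?thesis using p_inj K.zero_mem that by (metis inj_onD)
  qed
  have p_supp: "supp (p x) \<subseteq> X \<longleftrightarrow> supp x \<subseteq> \<beta> ` (X \<inter> A)" if "x \<in> K" for x X
  proof -
    have "supp x \<subseteq> \<beta> ` A" unfolding \<beta>A using inactive_zero[OF that] by (auto simp: supp_def)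
    show ?thesis
    proof
      assume s: "supp (p x) \<subseteq> X"
      show "supp x \<subseteq> \<beta> ` (X \<inter> A)"
      proof
        fix f assume f: "f \<in> supp x"
        then obtain e where e: "e \<in> A" "f = \<beta> e" using \<open>supp x \<subseteq> \<beta> ` A\<close> by blast
        hence "e \<in> supp (p x)" using f by (simp add: supp_def p_def pullback_def)
        thus "f \<in> \<beta> ` (X \<inter> A)" using e s by blast
      qed
    next
      assume s: "supp x \<subseteq> \<beta> ` (X \<inter> A)"
      show "supp (p x) \<subseteq> X"
      proof
        fix e assume "e \<in> supp (p x)"
        hence e: "e \<in> A" "\<beta> e \<in> supp x" by (auto simp: supp_def p_def pullback_def split: if_splits)
        thus "e \<in> X" using s \<beta>_inj by (auto simp: inj_on_def)
      qed
    qed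
  qed
  have "carries_flow L X \<longleftrightarrow> carries_flow (p ` K) X" for X
  proof -
    have "carries_flow L X \<longleftrightarrow> carries_flow L (X \<inter> A)"
      unfolding carries_flow_def A_def active_def supp_def by blast
    also have "\<dots> \<longleftrightarrow> carries_flow K (\<beta> ` (X \<inter> A))" using same[of "X \<inter> A"] by (simp add: A_def)
    also have "\<dots> \<longleftrightarrow> carries_flow (p ` K) X"
      unfolding carries_flow_def using p_supp p_zero by auto
    finally show ?thesis .
  qed
  then obtain s where s: "\<And>e. s e \<in> {-1, 1 :: int}" and pK: "p ` K = (\<lambda>x e. s e * x e) ` L"
    using unique_signing[OF LA.finite_ground LA.regular_lattice_axioms P.regular_lattice_axioms] by blast
  define sw where "sw = (\<lambda>x e. s e * x e :: int)"
  have s_sq: "s e * s e = 1" for e using s[of e] by auto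
  hence s_sq': "s e * (s e * a) = a" for e a by (metis mult.assoc mult_1)
  have "inj_on sw L"
    by (rule inj_on_inverseI[of _ sw]) (simp add: sw_def s_sq')
  hence bij_sw: "bij_betw sw L (p ` K)" using pK by (simp add: bij_betw_def sw_def)
  \<comment> \<open>Switch signs on the side of \<open>L\<close>, then rename the coordinates back to those of \<open>K\<close>.\<close>
  define q where "q = inv_into K p"
  have bij_q: "bij_betw q (p ` K) K"
    unfolding q_def by (rule bij_betw_inv_into) (use p_inj in \<open>simp add: bij_betw_def\<close>)
  have q_mem: "q u \<in> K" and pq: "p (q u) = u" if "u \<in> p ` K" for u
    using that by (auto simp: q_def inv_into_into f_inv_into_f)
  have sw_mem: "sw x \<in> p ` K" if "x \<in> L" for x using that pK by (auto simp: sw_def)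
  have ip_A: "int_dot E x y = int_dot A x y" if "x \<in> L" for x y
    unfolding int_dot_def by (rule sum.mono_neutral_right)
      (use L.finite_ground L.active_subset inactive_zero[OF that] in \<open>auto simp: A_def\<close>)
  have ip_p: "int_dot A (p x) (p y) = int_dot F x y" if "x \<in> K" for x y
  proof -
    have "int_dot A (p x) (p y) = (\<Sum>e\<in>A. x (\<beta> e) * y (\<beta> e))"
      unfolding int_dot_def by (intro sum.cong) (auto simp: p_def pullback_def)
    also have "\<dots> = (\<Sum>f\<in>active K. x f * y f)"
      unfolding \<beta>A[symmetric] by (simp add: sum.reindex[OF \<beta>_inj])
    also have "\<dots> = int_dot F x y"
      unfolding int_dot_def by (rule sum.mono_neutral_left)
        (use K.finite_ground K.active_subset inactive_zero[OF that] in \<open>auto\<close>)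
    finally show ?thesis .
  qed
  have "int_isometry E L F K (q \<circ> sw)"
    unfolding int_isometry_def
  proof (intro conjI ballI)
    show "bij_betw (q \<circ> sw) L K" using bij_sw bij_q by (rule bij_betw_trans)
    fix x y assume xy: "x \<in> L" "y \<in> L"
    have m: "sw x \<in> p ` K" "sw y \<in> p ` K" "sw (x - y) \<in> p ` K"
      using xy L.diff_mem sw_mem by blast+
    have "p (q (sw (x - y))) = p (q (sw x) - q (sw y))"
    proof -
      have "p (q (sw x) - q (sw y)) = p (q (sw x)) - p (q (sw y))" by (auto simp: p_def pullback_def)
      also have "\<dots> = sw x - sw y" using pq m by simp
      also have "\<dots> = sw (x - y)" by (auto simp: sw_def algebra_simps)
      finally show ?thesis using pq m by simp
    qed
    thus "(q \<circ> sw) (x - y) = (q \<circ> sw) x - (q \<circ> sw) y"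
      using p_inj q_mem m K.diff_mem by (auto simp: inj_on_def)
    have "int_dot F (q (sw x)) (q (sw y)) = int_dot A (sw x) (sw y)"
      using ip_p[OF q_mem[OF m(1)]] pq m by metis
    also have "\<dots> = int_dot A x y"
      unfolding int_dot_def sw_def using s_sq' by (intro sum.cong) (auto simp: algebra_simps)
    also have "\<dots> = int_dot E x y" using ip_A[OF xy(1)] by simp
    finally show "int_dot F ((q \<circ> sw) x) ((q \<circ> sw) y) = int_dot E x y" by simp
  qed
  thus ?thesis by blast
qed

theorem isometric_iff_flow_bijection:
  assumes "regular_lattice E L" and "regular_lattice F K"
  shows "(\<exists>\<psi>. int_isometry E L F K \<psi>) \<longleftrightarrow>
    (\<exists>\<beta>. bij_betw \<beta> (active L) (active K) \<and>
         (\<forall>X. X \<subseteq> active L \<longrightarrow> (carries_flow L X \<longleftrightarrow> carries_flow K (\<beta> ` X))))"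
    (is "?iso \<longleftrightarrow> ?bij")
proof
  assume ?iso
  then obtain \<psi> where \<psi>: "int_isometry E L F K \<psi>" by blast
  obtain \<beta> where "bij_betw \<beta> (active L) (active K)"
    "\<forall>X. X \<subseteq> active L \<longrightarrow> (carries_flow L X \<longleftrightarrow> carries_flow K (\<beta> ` X))"
    by (rule flow_bijection_of_isometry[OF assms \<psi>])
  thus ?bij by blast
next
  assume ?bij
  then obtain \<beta> where \<beta>: "bij_betw \<beta> (active L) (active K)"
    "\<forall>X. X \<subseteq> active L \<longrightarrow> (carries_flow L X \<longleftrightarrow> carries_flow K (\<beta> ` X))" by blast
  show ?iso by (rule isometry_of_flow_bijection[OF assms \<beta>(1)]) (use \<beta>(2) in blast)
qed

section \<open>Integer flows of a totally unimodular matrix\<close>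

definition int_flows :: "int mat \<Rightarrow> ('a \<Rightarrow> nat) \<Rightarrow> 'a set \<Rightarrow> ('a \<Rightarrow> int) set" where
  "int_flows A c E = {x. (\<forall>e. e \<notin> E \<longrightarrow> x e = 0) \<and> (\<forall>i<dim_row A. (\<Sum>e\<in>E. A $$ (i, c e) * x e) = 0)}"

lemma int_flows_sum:
  assumes "finite E" "X \<subseteq> E" "supp x \<subseteq> X"
  shows "(\<Sum>e\<in>X. A $$ (i, c e) * x e) = (\<Sum>e\<in>E. A $$ (i, c e) * x e)"
  using assms by (intro sum.mono_neutral_left) (auto simp: supp_def)

text \<open>The kernel vector of \<open>unimodular_kernel_vector\<close>, with columns renamed to matroid elements.\<close>
lemma int_flow_of_real_dependence:
  fixes a :: "'a \<Rightarrow> real"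
  assumes A: "totally_unimodular A" and E: "finite E" and c: "inj_on c E" "c ` E \<subseteq> {..<dim_col A}"
    and X: "X \<subseteq> E" and dep: "\<And>i. i < dim_row A \<Longrightarrow> (\<Sum>e\<in>X. a e * real_of_int (A $$ (i, c e))) = 0"
    and nz: "e0 \<in> X" "a e0 \<noteq> 0"
  obtains v where "v \<in> int_flows A c E" "v \<noteq> 0" "supp v \<subseteq> X" "\<forall>e. v e \<in> {-1, 0, 1}"
proof -
  have cX: "inj_on c X" using c(1) X by (rule inj_on_subset)
  define x where "x = a \<circ> inv_into X c"
  have xc: "x (c e) = a e" if "e \<in> X" for e using that cX by (simp add: x_def)
  have ker: "(\<Sum>j\<in>c ` X. real_of_int (A $$ (i, j)) * x j) = 0" if "i < dim_row A" for i
  proof -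
    have "(\<Sum>j\<in>c ` X. real_of_int (A $$ (i, j)) * x j) = (\<Sum>e\<in>X. a e * real_of_int (A $$ (i, c e)))"
      unfolding sum.reindex[OF cX] by (intro sum.cong) (auto simp: xc)
    thus ?thesis using dep that by simp
  qed
  have fin: "finite (c ` X)" using E X finite_subset by blast
  have sub: "c ` X \<subseteq> {..<dim_col A}" using c(2) X by blast
  have nz': "c e0 \<in> c ` X" "x (c e0) \<noteq> 0" using nz xc by auto
  obtain w :: "nat \<Rightarrow> int" where w: "\<And>j. w j \<in> {-1, 0, 1}" "\<And>j. j \<notin> c ` X \<Longrightarrow> w j = 0" "\<exists>j. w j \<noteq> 0"
    "\<And>i. i < dim_row A \<Longrightarrow> (\<Sum>j\<in>c ` X. A $$ (i, j) * w j) = 0"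
    using unimodular_kernel_vector[OF A fin sub ker nz'] by blast
  define v where "v = (\<lambda>e. if e \<in> X then w (c e) else 0)"
  show ?thesis
  proof
    show vX: "supp v \<subseteq> X" by (auto simp: v_def supp_def)
    show "\<forall>e. v e \<in> {-1, 0, 1}" using w(1) by (simp add: v_def)
    obtain j where j: "w j \<noteq> 0" using w(3) by blast
    then obtain e where "e \<in> X" "j = c e" using w(2) by blast
    hence "v e \<noteq> 0" using j by (simp add: v_def)
    thus "v \<noteq> 0" by auto
    have "(\<Sum>e\<in>E. A $$ (i, c e) * v e) = 0" if "i < dim_row A" for i
    proof -
      have "(\<Sum>e\<in>E. A $$ (i, c e) * v e) = (\<Sum>e\<in>X. A $$ (i, c e) * w (c e))"
        unfolding int_flows_sum[OF E X vX, symmetric] by (intro sum.cong) (auto simp: v_def)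
      also have "\<dots> = (\<Sum>j\<in>c ` X. A $$ (i, j) * w j)" by (simp add: sum.reindex[OF cX])
      finally show ?thesis using w(4) that by simp
    qed
    thus "v \<in> int_flows A c E" using X by (auto simp: int_flows_def v_def)
  qed
qed

text \<open>
  Flows with prescribed support suffice to obtain flows with prescribed signs. Let \<open>v\<close> be a unit flow
  inside the support of \<open>x\<close> that agrees in sign with \<open>x\<close> somewhere. Subtract from \<open>x\<close> the largest
  multiple of \<open>v\<close> that does not change any sign. This kills a coordinate; either it kills \<open>x\<close>, so that
  \<open>v\<close> has the signs of \<open>x\<close>, or the remainder is a smaller flow with signs taken from \<open>x\<close>.
\<close>
lemma conformal_from_supports:
  assumes zero: "0 \<in> L" and diff: "\<And>x y. x \<in> L \<Longrightarrow> y \<in> L \<Longrightarrow> x - y \<in> L"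
    and fin: "\<And>x. x \<in> L \<Longrightarrow> finite (supp x)"
    and unit: "\<And>x. x \<in> L \<Longrightarrow> x \<noteq> 0 \<Longrightarrow> \<exists>v\<in>L. v \<noteq> 0 \<and> supp v \<subseteq> supp x \<and> (\<forall>e. v e \<in> {-1, 0, 1 :: int})"
    and x: "x \<in> L" "x \<noteq> 0"
  shows "\<exists>c\<in>L. c \<noteq> 0 \<and> sign_part c x"
  using x
proof (induction "card (supp x)" arbitrary: x rule: less_induct)
  case less
  obtain w where w: "w \<in> L" "w \<noteq> 0" "supp w \<subseteq> supp x" "\<And>e. w e \<in> {-1, 0, 1}"
    using unit less.prems by blast
  obtain g where g: "w g \<noteq> 0" using w(2) by (rule nonzero_obtain)
  \<comment> \<open>The sign makes \<open>v\<close> agree with \<open>x\<close> at \<open>g\<close>; \<open>h\<close> below is the first coordinate that gets exhausted.\<close>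
  define v where "v = (\<lambda>e. sgn (w g * x g) * w e)"
  have xg: "x g \<noteq> 0" using g w(3) by (auto simp: supp_def)
  have vL: "v \<in> L" unfolding v_def by (rule subgroup_scale[OF zero diff w(1)])
  have vx: "supp v \<subseteq> supp x" using w(3) by (auto simp: v_def supp_def)
  have vu: "v e \<in> {-1, 0, 1}" for e using w(4)[of e] by (auto simp: v_def sgn_if)
  define D where "D = {e. v e * x e > 0}"
  have "g \<in> D" using g xg w(4)[of g] by (auto simp: D_def v_def sgn_if zero_less_mult_iff)
  have "D \<subseteq> supp x" by (auto simp: D_def supp_def)
  hence "finite D" using fin less.prems(1) finite_subset by blast
  obtain h where h: "h \<in> D" and h_min: "\<And>e. e \<in> D \<Longrightarrow> \<bar>x h\<bar> \<le> \<bar>x e\<bar>"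
    using ex_min_if_finite[of "(\<lambda>e. \<bar>x e\<bar>) ` D"] \<open>finite D\<close> \<open>g \<in> D\<close> by (auto simp: not_less)
  define z where "z = x - (\<lambda>e. \<bar>x h\<bar> * v e)"
  have zL: "z \<in> L" unfolding z_def using less.prems(1) subgroup_scale[OF zero diff vL] by (rule diff)
  have z_sgn: "z e = 0 \<or> sgn (z e) = sgn (x e)" for e
  proof (cases "e \<in> D")
    case True
    thus ?thesis using h_min[OF True] vu[of e] by (auto simp: z_def D_def sgn_if)
  next
    case False
    have "x e = 0 \<Longrightarrow> v e = 0" using vx by (rule supp_subsetD)
    thus ?thesis using False vu[of e] h by (auto simp: z_def D_def sgn_if zero_less_mult_iff)
  qed
  show ?case
  proof (cases "z = 0")
    case True
    have "sign_part v x"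
      unfolding sign_part_def
    proof
      fix e
      have "x e = \<bar>x h\<bar> * v e" using fun_cong[OF True, of e] by (simp add: z_def)
      moreover have "\<bar>x h\<bar> > 0" using h by (auto simp: D_def)
      ultimately show "v e = 0 \<or> v e = sgn (x e)" using vu[of e] by (auto simp: sgn_mult)
    qed
    moreover have "v g \<noteq> 0" using \<open>g \<in> D\<close> by (auto simp: D_def)
    hence "v \<noteq> 0" by auto
    ultimately show ?thesis using vL by blast
  next
    case False
    have "supp z \<subseteq> supp x" using vx by (auto simp: z_def supp_def)
    moreover have "z h = 0" using h vu[of h] by (auto simp: z_def D_def abs_if)
    moreover have "x h \<noteq> 0" using h by (auto simp: D_def)
    ultimately have "supp z \<subset> supp x" by (auto simp: supp_def)
    hence "card (supp z) < card (supp x)" using fin less.prems(1) by (intro psubset_card_mono)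
    then obtain c where c: "c \<in> L" "c \<noteq> 0" "sign_part c z" using less.hyps zL False by blast
    have "sign_part c x"
      unfolding sign_part_def
    proof
      fix e show "c e = 0 \<or> c e = sgn (x e)"
        using z_sgn[of e] c(3) unfolding sign_part_def by (metis sgn_0)
    qed
    thus ?thesis using c by blast
  qed
qed

lemma int_flows_regular:
  assumes A: "totally_unimodular A" and E: "finite E" and c: "inj_on c E" "c ` E \<subseteq> {..<dim_col A}"
  shows "regular_lattice E (int_flows A c E)"
proof
  let ?L = "int_flows A c E"
  show zero: "0 \<in> ?L" by (simp add: int_flows_def)
  show diff: "x - y \<in> ?L" if "x \<in> ?L" "y \<in> ?L" for x y
    using that by (auto simp: int_flows_def right_diff_distrib sum_subtractf)
  show "finite E" by fact
  show "x e = 0" if "x \<in> ?L" "e \<notin> E" for x e using that by (simp add: int_flows_def)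
  fix x assume x: "x \<in> ?L" "x \<noteq> 0"
  show "\<exists>c\<in>?L. c \<noteq> 0 \<and> sign_part c x"
  proof (rule conformal_from_supports[OF zero diff _ _ x])
    fix y assume y: "y \<in> ?L"
    hence yE: "supp y \<subseteq> E" by (auto simp: int_flows_def supp_def)
    thus "finite (supp y)" using E finite_subset by blast
    assume "y \<noteq> 0"
    then obtain e where e: "y e \<noteq> 0" by (rule nonzero_obtain)
    have "(\<Sum>e\<in>supp y. real_of_int (y e) * real_of_int (A $$ (i, c e))) = 0" if "i < dim_row A" for i
    proof -
      have "(\<Sum>e\<in>supp y. A $$ (i, c e) * y e) = 0"
        using int_flows_sum[OF E yE order_refl, of A i c] y that by (simp add: int_flows_def)
      hence "real_of_int (\<Sum>e\<in>supp y. A $$ (i, c e) * y e) = 0" by simp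
      thus ?thesis by (simp add: mult.commute)
    qed
    moreover have "e \<in> supp y" "real_of_int (y e) \<noteq> 0" using e by (auto simp: supp_def)
    ultimately obtain v where "v \<in> ?L" "v \<noteq> 0" "supp v \<subseteq> supp y" "\<forall>e. v e \<in> {-1, 0, 1}"
      by (rule int_flow_of_real_dependence[OF A E c yE])
    thus "\<exists>v\<in>?L. v \<noteq> 0 \<and> supp v \<subseteq> supp y \<and> (\<forall>e. v e \<in> {-1, 0, 1})" by blast
  qed
qed

text \<open>Real dependences among the columns may be replaced by integer flows inside the same set.\<close>
lemma indep_column_matroid_iff:
  assumes A: "totally_unimodular A" and E: "finite E" and c: "inj_on c E" "c ` E \<subseteq> {..<dim_col A}"
  shows "X \<in> indep (column_matroid A c E) \<longleftrightarrow> X \<subseteq> E \<and> \<not> carries_flow (int_flows A c E) X"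
proof (cases "X \<subseteq> E")
  case True
  have "carries_flow (int_flows A c E) X \<longleftrightarrow>
    (\<exists>a :: 'a \<Rightarrow> real. (\<forall>i<dim_row A. (\<Sum>e\<in>X. a e * real_of_int (A $$ (i, c e))) = 0) \<and> (\<exists>e\<in>X. a e \<noteq> 0))"
    (is "_ \<longleftrightarrow> ?dep")
  proof
    assume "carries_flow (int_flows A c E) X"
    then obtain x where x: "x \<in> int_flows A c E" "x \<noteq> 0" "supp x \<subseteq> X" by (auto simp: carries_flow_def)
    obtain e where e: "x e \<noteq> 0" using x(2) by (rule nonzero_obtain)
    have "(\<Sum>e\<in>X. real_of_int (x e) * real_of_int (A $$ (i, c e))) = 0" if "i < dim_row A" for i
    proof -
      have "(\<Sum>e\<in>X. A $$ (i, c e) * x e) = 0"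
        using int_flows_sum[OF E True x(3), of A i c] x(1) that by (simp add: int_flows_def)
      hence "real_of_int (\<Sum>e\<in>X. A $$ (i, c e) * x e) = 0" by simp
      thus ?thesis by (simp add: mult.commute)
    qed
    moreover have "e \<in> X" using e x(3) by (auto simp: supp_def)
    ultimately show ?dep using e by (intro exI[of _ "\<lambda>e. real_of_int (x e)"]) auto
  next
    assume ?dep
    then obtain a :: "'a \<Rightarrow> real" and e where
      a: "\<And>i. i < dim_row A \<Longrightarrow> (\<Sum>e\<in>X. a e * real_of_int (A $$ (i, c e))) = 0" "e \<in> X" "a e \<noteq> 0"
      by blast
    obtain v where "v \<in> int_flows A c E" "v \<noteq> 0" "supp v \<subseteq> X"
      by (rule int_flow_of_real_dependence[OF A E c True a])
    thus "carries_flow (int_flows A c E) X" by (auto simp: carries_flow_def)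
  qed
  thus ?thesis using True by (auto simp: column_matroid_def)
qed (simp add: column_matroid_def)

section \<open>Coloops\<close>

text \<open>
  If all flows vanish at \<open>e\<close>, then \<open>e\<close> can be added to any independent set. Conversely, take a largest
  independent set \<open>B\<close> that avoids a coloop \<open>e\<close>. As \<open>B\<close> is not a basis, \<open>insert e B\<close> is independent, and
  every other element \<open>f\<close> lies on a flow supported in \<open>insert f B\<close>. Such flows vanish at \<open>e\<close>, and they
  eliminate from any flow all coordinates outside \<open>insert e B\<close> without affecting whether its entry at
  \<open>e\<close> is zero. What remains is zero by independence.
\<close>
lemma coloops_iff_inactive:
  assumes L: "regular_lattice (ground M) L"
    and indep: "\<And>X. X \<in> indep M \<longleftrightarrow> X \<subseteq> ground M \<and> \<not> carries_flow L X"
  shows "coloops M = ground M - active L"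
proof (intro Set.set_eqI iffI)
  interpret L: regular_lattice "ground M" L by fact
  have mono: "carries_flow L Y" if "carries_flow L X" "X \<subseteq> Y" for X Y
    using that by (auto simp: carries_flow_def)
  fix e
  {
    assume "e \<in> ground M - active L"
    hence e: "e \<in> ground M" "\<And>x. x \<in> L \<Longrightarrow> x e = 0" by (auto simp: active_def)
    have "e \<in> B" if B: "basis_of M (ground M) B" for B
    proof -
      have "supp x \<subseteq> B" if "x \<in> L" "supp x \<subseteq> insert e B" for x
        using that(2) e(2)[OF that(1)] by (auto simp: supp_def)
      moreover have "\<not> carries_flow L B" using B by (simp add: basis_of_def indep)
      ultimately have "\<not> carries_flow L (insert e B)" unfolding carries_flow_def by blast
      hence "insert e B \<in> indep M" using B e(1) by (auto simp: indep basis_of_def)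
      hence "insert e B = B" using B e(1) by (auto simp: basis_of_def)
      thus ?thesis by blast
    qed
    thus "e \<in> coloops M" using e(1) by (auto simp: coloops_def)
  }
  assume "e \<in> coloops M"
  hence e: "e \<in> ground M" "\<And>B. basis_of M (ground M) B \<Longrightarrow> e \<in> B" by (auto simp: coloops_def)
  define P where "P = (\<lambda>B. B \<in> indep M \<and> e \<notin> B)"
  have "P {}" by (auto simp: P_def indep carries_flow_def supp_def fun_eq_iff)
  moreover have "\<forall>B. P B \<longrightarrow> card B < Suc (card (ground M))"
    using L.finite_ground by (auto simp: P_def indep less_Suc_eq_le intro: card_mono)
  ultimately have "\<exists>B. P B \<and> (\<forall>B'. P B' \<longrightarrow> card B' \<le> card B)"
    by (rule ex_has_greatest_nat)
  then obtain B where B: "P B" and max: "\<And>B'. P B' \<Longrightarrow> card B' \<le> card B" by blast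
  have B': "B \<subseteq> ground M" "\<not> carries_flow L B" "e \<notin> B" using B by (auto simp: P_def indep)
  have finB: "finite B" using B'(1) L.finite_ground finite_subset by blast
  have ext: "carries_flow L (insert f B)" if "f \<in> ground M" "f \<notin> insert e B" for f
  proof (rule ccontr)
    assume "\<not> ?thesis"
    hence "P (insert f B)" using that B' by (auto simp: P_def indep)
    from max[OF this] finB that show False by simp
  qed
  have ind: "insert e B \<in> indep M"
  proof (rule ccontr)
    assume not: "insert e B \<notin> indep M"
    have "basis_of M (ground M) B"
      unfolding basis_of_def
    proof (intro conjI ballI impI)
      show "B \<in> indep M" "B \<subseteq> ground M" using B B'(1) by (auto simp: P_def)
      fix B2 assume B2: "B2 \<in> indep M" "B \<subseteq> B2" "B2 \<subseteq> ground M"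
      show "B2 = B"
      proof (rule ccontr)
        assume "B2 \<noteq> B"
        then obtain f where f: "f \<in> B2" "f \<notin> B" using B2(2) by blast
        have "carries_flow L (insert f B)"
        proof (cases "f = e")
          case True
          thus ?thesis using not e(1) B'(1) by (auto simp: indep)
        next
          case False
          thus ?thesis using ext[of f] f B2(3) by auto
        qed
        hence "carries_flow L B2" by (rule mono) (use f B2 in auto)
        thus False using B2(1) by (simp add: indep)
      qed
    qed
    with e(2) B'(3) show False by blast
  qed
  have "x e = 0" if "x \<in> L" for x
    using that
  proof (induction "card (supp x - insert e B)" arbitrary: x rule: less_induct)
    case less
    show ?case
    proof (cases "supp x \<subseteq> insert e B")
      case True
      have "x = 0" using ind True less.prems by (auto simp: indep carries_flow_def)
      thus ?thesis by simp
    next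
      case False
      then obtain f where f: "x f \<noteq> 0" "f \<notin> insert e B" by (auto simp: supp_def)
      hence "f \<in> ground M" using L.outside less.prems by blast
      then obtain w where w: "w \<in> L" "w \<noteq> 0" "supp w \<subseteq> insert f B"
        using ext f(2) by (auto simp: carries_flow_def)
      have "w f \<noteq> 0"
      proof
        assume "w f = 0"
        hence "supp w \<subseteq> B" using w(3) by (auto simp: supp_def)
        thus False using B'(2) w(1,2) by (auto simp: carries_flow_def)
      qed
      have we: "w e = 0" using w(3) f(2) B'(3) by (auto simp: supp_def)
      define z where "z = (\<lambda>g. w f * x g - x f * w g)"
      have zL: "z \<in> L" unfolding z_def using less.prems w(1) by (rule L.comb_mem)
      have "z f = 0" by (simp add: z_def)
      moreover have "z g = 0" if "x g = 0" "g \<notin> insert e B" for g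
        using that w(3) f(1) by (auto simp: z_def supp_def)
      ultimately have "supp z - insert e B \<subset> supp x - insert e B"
        using f by (auto simp: supp_def)
      hence "card (supp z - insert e B) < card (supp x - insert e B)"
        using L.finite_supp[OF less.prems] by (intro psubset_card_mono) auto
      hence "z e = 0" using less.hyps zL by blast
      thus ?thesis using \<open>w f \<noteq> 0\<close> we by (simp add: z_def)
    qed
  qed
  thus "e \<in> ground M - active L" using e(1) by (auto simp: active_def)
qed

text \<open>
  The coloops form an independent set, so it is its own only basis; and adding coordinates on which
  all flows vanish does not change whether a set supports a flow.
\<close>
lemma contract_coloops_iff:
  assumes L: "regular_lattice (ground M) L"
    and indep: "\<And>X. X \<in> indep M \<longleftrightarrow> X \<subseteq> ground M \<and> \<not> carries_flow L X"
  shows "ground (contract_coloops M) = active L"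
    and "X \<in> indep (contract_coloops M) \<longleftrightarrow> X \<subseteq> active L \<and> \<not> carries_flow L X"
proof -
  interpret L: regular_lattice "ground M" L by fact
  define T where "T = coloops M"
  have T: "T = ground M - active L" unfolding T_def using L indep by (rule coloops_iff_inactive)
  have gT: "ground M - T = active L" using L.active_subset by (auto simp: T)
  show "ground (contract_coloops M) = active L"
    using gT by (simp add: contract_coloops_def contract_def T_def)
  have union_T: "carries_flow L (X \<union> T) \<longleftrightarrow> carries_flow L X" for X
    unfolding carries_flow_def T active_def supp_def by blast
  have "\<not> carries_flow L {}" by (auto simp: carries_flow_def supp_def fun_eq_iff)
  hence "\<not> carries_flow L T" using union_T[of "{}"] by simp
  hence "T \<in> indep M" by (simp add: indep T)
  hence "basis_of M (T \<inter> ground M) B \<longleftrightarrow> B = T" for B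
    unfolding basis_of_def using T by blast
  hence "X \<in> indep (contract_coloops M) \<longleftrightarrow> X \<subseteq> active L \<and> X \<union> T \<in> indep M"
    using gT by (simp add: contract_coloops_def contract_def T_def)
  thus "X \<in> indep (contract_coloops M) \<longleftrightarrow> X \<subseteq> active L \<and> \<not> carries_flow L X"
    unfolding indep union_T using L.active_subset by (auto simp: T)
qed

section \<open>The form group of real-valued flows\<close>

lemma carrier_flow_lattice:
  "carrier (flow_lattice A c E) = (\<lambda>x e. real_of_int (x e)) ` int_flows A c E"
proof (intro Set.set_eqI iffI)
  fix x assume "x \<in> carrier (flow_lattice A c E)"
  hence x: "\<And>e. e \<notin> E \<Longrightarrow> x e = 0" "\<And>e. e \<in> E \<Longrightarrow> x e \<in> \<int>"
    "\<And>i. i < dim_row A \<Longrightarrow> (\<Sum>e\<in>E. real_of_int (A $$ (i, c e)) * x e) = 0"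
    by (auto simp: flow_lattice_def)
  define y where "y = (\<lambda>e. \<lfloor>x e\<rfloor>)"
  have xy: "x e = real_of_int (y e)" for e
    using x(1,2) by (cases "e \<in> E") (auto simp: y_def)
  have "(\<Sum>e\<in>E. A $$ (i, c e) * y e) = 0" if "i < dim_row A" for i
  proof -
    have "real_of_int (\<Sum>e\<in>E. A $$ (i, c e) * y e) = 0" using x(3)[OF that] by (simp add: xy)
    thus ?thesis by linarith
  qed
  moreover have "y e = 0" if "e \<notin> E" for e using x(1)[OF that] by (simp add: y_def)
  ultimately have "y \<in> int_flows A c E" by (simp add: int_flows_def)
  thus "x \<in> (\<lambda>x e. real_of_int (x e)) ` int_flows A c E" using xy by (intro image_eqI[of _ _ y]) auto
next
  fix x assume "x \<in> (\<lambda>x e. real_of_int (x e)) ` int_flows A c E"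
  then obtain y where y: "y \<in> int_flows A c E" "x = (\<lambda>e. real_of_int (y e))" by blast
  have "(\<Sum>e\<in>E. real_of_int (A $$ (i, c e)) * real_of_int (y e)) = 0" if "i < dim_row A" for i
  proof -
    have "real_of_int (\<Sum>e\<in>E. A $$ (i, c e) * y e) = 0" using y(1) that by (simp add: int_flows_def)
    thus ?thesis by simp
  qed
  thus "x \<in> carrier (flow_lattice A c E)"
    using y by (auto simp: flow_lattice_def int_flows_def)
qed

text \<open>
  An inverse of a bijective homomorphism is one, so that an isometry only needs to be checked in
  one direction.
\<close>
lemma form_hom_inverse:
  assumes bij: "bij_betw \<psi> (carrier L) (carrier L')" and hom: "form_hom L L' \<psi>"
    and closed: "\<And>x y. x \<in> carrier L \<Longrightarrow> y \<in> carrier L \<Longrightarrow> x \<otimes>\<^bsub>L\<^esub> y \<in> carrier L"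
  shows "form_hom L' L (inv_into (carrier L) \<psi>)"
proof -
  let ?i = "inv_into (carrier L) \<psi>"
  have i: "?i (\<psi> a) = a" if "a \<in> carrier L" for a using bij that by (simp add: bij_betw_def)
  have ex: "\<exists>a\<in>carrier L. x = \<psi> a" if "x \<in> carrier L'" for x using bij that by (auto simp: bij_betw_def)
  have h: "\<psi> (a \<otimes>\<^bsub>L\<^esub> b) = \<psi> a \<otimes>\<^bsub>L'\<^esub> \<psi> b" "form L' (\<psi> a) (\<psi> b) = form L a b"
    if "a \<in> carrier L" "b \<in> carrier L" for a b
    using hom that by (auto simp: form_hom_def hom_def)
  show ?thesis
    unfolding form_hom_def hom_def
  proof (intro conjI CollectI ballI)
    show "?i \<in> carrier L' \<rightarrow> carrier L" using ex i by force
    fix x y assume "x \<in> carrier L'" "y \<in> carrier L'"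
    then obtain a b where ab: "a \<in> carrier L" "b \<in> carrier L" "x = \<psi> a" "y = \<psi> b" using ex by blast
    show "?i (x \<otimes>\<^bsub>L'\<^esub> y) = ?i x \<otimes>\<^bsub>L\<^esub> ?i y" using ab h(1)[OF ab(1,2)] i closed by metis
    show "form L (?i x) (?i y) = form L' x y" using ab h(2)[OF ab(1,2)] i by simp
  qed
qed

lemma isometric_flow_lattice_iff:
  assumes L: "regular_lattice E (int_flows A c E)" and K: "regular_lattice F (int_flows B d F)"
  shows "isometric (flow_lattice A c E) (flow_lattice B d F) \<longleftrightarrow>
    (\<exists>\<psi>. int_isometry E (int_flows A c E) F (int_flows B d F) \<psi>)"
proof -
  let ?L = "int_flows A c E" and ?K = "int_flows B d F"
  let ?LR = "flow_lattice A c E" and ?KR = "flow_lattice B d F"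
  interpret L: regular_lattice E ?L by fact
  interpret K: regular_lattice F ?K by fact
  define r where "r = (\<lambda>(x :: 'a \<Rightarrow> int) e. real_of_int (x e))"
  define r' where "r' = (\<lambda>(x :: 'b \<Rightarrow> int) e. real_of_int (x e))"
  define t where "t = (\<lambda>(x :: 'a \<Rightarrow> real) e. \<lfloor>x e\<rfloor>)"
  define t' where "t' = (\<lambda>(x :: 'b \<Rightarrow> real) e. \<lfloor>x e\<rfloor>)"
  have tr: "t (r x) = x" and tr': "t' (r' y) = y" for x y by (auto simp: t_def r_def t'_def r'_def)
  have cL: "carrier ?LR = r ` ?L" and cK: "carrier ?KR = r' ` ?K"
    by (simp_all add: carrier_flow_lattice r_def r'_def)
  have rL: "bij_betw r ?L (carrier ?LR)"
    unfolding cL by (intro bij_betw_imageI inj_on_inverseI[of _ t]) (auto simp: tr)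
  have rK: "bij_betw r' ?K (carrier ?KR)"
    unfolding cK by (intro bij_betw_imageI inj_on_inverseI[of _ t']) (auto simp: tr')
  have tL: "bij_betw t (carrier ?LR) ?L"
    unfolding cL by (rule bij_betw_byWitness[of _ r]) (auto simp: tr)
  have tK: "bij_betw t' (carrier ?KR) ?K"
    unfolding cK by (rule bij_betw_byWitness[of _ r']) (auto simp: tr')
  have mL: "r x \<otimes>\<^bsub>?LR\<^esub> r y = r (x + y)" for x y by (auto simp: flow_lattice_def r_def)
  have mK: "r' x \<otimes>\<^bsub>?KR\<^esub> r' y = r' (x + y)" for x y by (auto simp: flow_lattice_def r'_def)
  have fL: "form ?LR (r x) (r y) = real_of_int (int_dot E x y)" for x y by (simp add: flow_lattice_def r_def int_dot_def)
  have fK: "form ?KR (r' x) (r' y) = real_of_int (int_dot F x y)" for x y by (simp add: flow_lattice_def r'_def int_dot_def)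
  show ?thesis
  proof
    assume "isometric ?LR ?KR"
    then obtain \<psi> where bij: "bij_betw \<psi> (carrier ?LR) (carrier ?KR)" and hom: "form_hom ?LR ?KR \<psi>"
      by (auto simp: isometric_def isometry_def)
    define \<phi> where "\<phi> = t' \<circ> (\<psi> \<circ> r)"
    have \<phi>_bij: "bij_betw \<phi> ?L ?K"
      unfolding \<phi>_def by (rule bij_betw_trans[OF bij_betw_trans[OF rL bij] tK])
    have \<psi>r: "\<psi> (r x) = r' (\<phi> x)" if x: "x \<in> ?L" for x
    proof -
      have "\<psi> (r x) \<in> r' ` ?K" using bij x unfolding cL cK bij_betw_def by blast
      thus ?thesis using tr' by (auto simp: \<phi>_def)
    qed
    have add: "\<phi> (x + y) = \<phi> x + \<phi> y" if xy: "x \<in> ?L" "y \<in> ?L" for x y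
    proof -
      have "r' (\<phi> (x + y)) = \<psi> (r x \<otimes>\<^bsub>?LR\<^esub> r y)" unfolding mL using \<psi>r[OF L.add_mem[OF xy]] by simp
      also have "\<dots> = \<psi> (r x) \<otimes>\<^bsub>?KR\<^esub> \<psi> (r y)"
        using hom xy unfolding form_hom_def hom_def cL by blast
      also have "\<dots> = r' (\<phi> x + \<phi> y)" unfolding \<psi>r[OF xy(1)] \<psi>r[OF xy(2)] mK ..
      finally show ?thesis using tr' by metis
    qed
    have "int_isometry E ?L F ?K \<phi>"
      unfolding int_isometry_def
    proof (intro conjI ballI \<phi>_bij)
      fix x y assume xy: "x \<in> ?L" "y \<in> ?L"
      show "\<phi> (x - y) = \<phi> x - \<phi> y"
        using add[OF L.diff_mem[OF xy] xy(2)] by (simp add: algebra_simps)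
      have "form ?KR (\<psi> (r x)) (\<psi> (r y)) = form ?LR (r x) (r y)"
        using hom xy unfolding form_hom_def cL by blast
      thus "int_dot F (\<phi> x) (\<phi> y) = int_dot E x y"
        unfolding \<psi>r[OF xy(1)] \<psi>r[OF xy(2)] fL fK by simp
    qed
    thus "\<exists>\<psi>. int_isometry E ?L F ?K \<psi>" by blast
  next
    assume "\<exists>\<psi>. int_isometry E ?L F ?K \<psi>"
    then obtain \<phi> where \<phi>: "bij_betw \<phi> ?L ?K"
      and diff: "\<And>x y. x \<in> ?L \<Longrightarrow> y \<in> ?L \<Longrightarrow> \<phi> (x - y) = \<phi> x - \<phi> y"
      and ip: "\<And>x y. x \<in> ?L \<Longrightarrow> y \<in> ?L \<Longrightarrow> int_dot F (\<phi> x) (\<phi> y) = int_dot E x y"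
      by (auto simp: int_isometry_def)
    have add: "\<phi> (x + y) = \<phi> x + \<phi> y" if "x \<in> ?L" "y \<in> ?L" for x y
      using diff[OF L.add_mem[OF that] that(2)] by (simp add: algebra_simps)
    define \<psi> where "\<psi> = r' \<circ> (\<phi> \<circ> t)"
    have bij: "bij_betw \<psi> (carrier ?LR) (carrier ?KR)"
      unfolding \<psi>_def by (rule bij_betw_trans[OF bij_betw_trans[OF tL \<phi>] rK])
    have \<psi>r: "\<psi> (r x) = r' (\<phi> x)" for x by (simp add: \<psi>_def tr)
    have hom: "form_hom ?LR ?KR \<psi>"
      unfolding form_hom_def hom_def
    proof (intro conjI CollectI ballI)
      show "\<psi> \<in> carrier ?LR \<rightarrow> carrier ?KR" using bij by (auto simp: bij_betw_def)
      fix x y assume "x \<in> carrier ?LR" "y \<in> carrier ?LR"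
      then obtain a b where ab: "a \<in> ?L" "b \<in> ?L" "x = r a" "y = r b" unfolding cL by blast
      show "\<psi> (x \<otimes>\<^bsub>?LR\<^esub> y) = \<psi> x \<otimes>\<^bsub>?KR\<^esub> \<psi> y"
        unfolding ab(3,4) mL \<psi>r mK using add[OF ab(1,2)] by simp
      show "form ?KR (\<psi> x) (\<psi> y) = form ?LR x y"
        unfolding ab(3,4) \<psi>r fL fK using ip[OF ab(1,2)] by simp
    qed
    have "x \<otimes>\<^bsub>?LR\<^esub> y \<in> carrier ?LR" if "x \<in> carrier ?LR" "y \<in> carrier ?LR" for x y
      using that L.add_mem unfolding cL by (auto simp: mL)
    hence "form_hom ?KR ?LR (inv_into (carrier ?LR) \<psi>)" by (rule form_hom_inverse[OF bij hom])
    with bij hom show "isometric ?LR ?KR" by (auto simp: isometric_def isometry_def)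
  qed
qed

lemma represents_flows:
  assumes "represents A c M" and "finite (ground M)"
  shows "regular_lattice (ground M) (int_flows A c (ground M))"
    and "X \<in> indep M \<longleftrightarrow> X \<subseteq> ground M \<and> \<not> carries_flow (int_flows A c (ground M)) X"
proof -
  have A: "totally_unimodular A" and M: "M = column_matroid A c (ground M)"
    and c: "inj_on c (ground M)" "c ` ground M \<subseteq> {..<dim_col A}"
    using assms(1) by (auto simp: represents_def bij_betw_def)
  show "regular_lattice (ground M) (int_flows A c (ground M))"
    by (rule int_flows_regular[OF A assms(2) c])
  show "X \<in> indep M \<longleftrightarrow> X \<subseteq> ground M \<and> \<not> carries_flow (int_flows A c (ground M)) X"
    by (subst M) (rule indep_column_matroid_iff[OF A assms(2) c])
qed

theorem theorem1:
  fixes M :: "'a matroid" and N :: "'b matroid"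
    and A B :: "int mat" and c :: "'a \<Rightarrow> nat" and d :: "'b \<Rightarrow> nat"
  assumes "regular_matroid M" and "regular_matroid N"
    and "represents A c M" and "represents B d N"
  shows "isometric (flow_lattice A c (ground M)) (flow_lattice B d (ground N)) \<longleftrightarrow>
         matroid_isomorphic (contract_coloops M) (contract_coloops N)"
proof -
  let ?L = "int_flows A c (ground M)" and ?K = "int_flows B d (ground N)"
  have "finite (ground M)" "finite (ground N)"
    using assms(1,2) by (auto simp: regular_matroid_def is_matroid_def)
  note M = represents_flows[OF assms(3) this(1)] and N = represents_flows[OF assms(4) this(2)]
  note M' = contract_coloops_iff[OF M] and N' = contract_coloops_iff[OF N]
  have "isometric (flow_lattice A c (ground M)) (flow_lattice B d (ground N)) \<longleftrightarrow>
    (\<exists>\<beta>. bij_betw \<beta> (active ?L) (active ?K) \<and>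
         (\<forall>X. X \<subseteq> active ?L \<longrightarrow> (carries_flow ?L X \<longleftrightarrow> carries_flow ?K (\<beta> ` X))))"
    unfolding isometric_flow_lattice_iff[OF M(1) N(1)] isometric_iff_flow_bijection[OF M(1) N(1)] ..
  also have "\<dots> \<longleftrightarrow> matroid_isomorphic (contract_coloops M) (contract_coloops N)"
    unfolding matroid_isomorphic_def M' N'
  proof (intro ex_cong1 conj_cong refl all_cong1 imp_cong)
    fix \<beta> X assume "bij_betw \<beta> (active ?L) (active ?K)" "X \<subseteq> active ?L"
    hence "\<beta> ` X \<subseteq> active ?K" by (auto simp: bij_betw_def)
    with \<open>X \<subseteq> active ?L\<close>
    show "(carries_flow ?L X = carries_flow ?K (\<beta> ` X)) =
      ((X \<subseteq> active ?L \<and> \<not> carries_flow ?L X) = (\<beta> ` X \<subseteq> active ?K \<and> \<not> carries_flow ?K (\<beta> ` X)))"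
      by simp
  qed
  finally show ?thesis .
qed

end
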